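(* Let $k$ be an algebraically closed field of characteristic zero, $n\ge3$, $R=k[x_1,\ldots,x_n]$, and let $\mathbf d=(1,d_2,d_3)$ with $1<d_2\le d_3$. Then every ideal $J$ with degree vector $\mathbf d$ satisfies $\mathrm{indeg}(\mathrm{Syz}(J))=d_2+1$, and $I_{d_2+1,\mathbf d}=[0,d_2]\cap\mathbb Z$. Moreover, the admissible pair $(d_2+1,j)$ is realizable if and only if $0\le j\le d_2-1$. Thus $j=d_2$ is the unique nonrealizable value in this interval.
   Context: For $\mathbf d=(d_1,d_2,d_3)$ with $1\le d_1\le d_2\le d_3$, an ideal with degree vector $\mathbf d$ is an ideal $J=(f_1,f_2,f_3)\subseteq R$ minimally generated by homogeneous forms with $\deg f_i=d_i$ and $\gcd(f_1,f_2,f_3)=1$. $\mathrm{Syz}(J)$ is the kernel of $\bigoplus_{i=1}^3R(-d_i)\xrightarrow{[f_1\ f_2\ f_3]}J$, graded as a submodule of $\bigoplus_iR(-d_i)$ ("shifted" grading): a syzygy $(a_1,a_2,a_3)$ has shifted degree $q$ if $\deg a_i=q-d_i$ whenever $a_i\neq0$. $\mathrm{indeg}(\mathrm{Syz}(J))$ is the least $q$ with $\mathrm{Syz}(J)_q\ne0$. $\deg(R/J)$ is the codimension-two degree $\sum_{\mathfrak p\in\mathrm{Ass}(R/J),\,\mathrm{ht}\,\mathfrak p=2}\mathrm{length}((R/J)_{\mathfrak p})\deg(R/\mathfrak p)$: the usual multiplicity if $\mathrm{ht}(J)=2$, and $0$ if $\mathrm{ht}(J)\ge3$. With $D=d_1+d_2+d_3$,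 $\sigma=d_1d_2+d_1d_3+d_2d_3$ and $F_{\mathbf d}(e)=e^2-eD+\sigma$, put $I_{e,\mathbf d}=[\max\{\sigma-eD,0\},F_{\mathbf d}(e)]\cap\mathbb Z$. A pair $(e,j)\in\mathbb Z^2$ is admissible for $\mathbf d$ if $d_2<e\le d_1+d_2$ and $j\in I_{e,\mathbf d}$. It is realizable over $R$ if there is an ideal $J\subseteq R$ with degree vector $\mathbf d$ such that $\mathrm{indeg}(\mathrm{Syz}(J))=e$ and $\deg(R/J)=j$. *)

theory Defs
  imports Complex_Main "HOL-Library.Cardinality" "HOL-Library.Poly_Mapping" "HOL-Library.Extended_Nat"
    "HOL-Computational_Algebra.Polynomial"
begin

section \<open>Commutative algebra over a ring type\<close>

text \<open>A commutative ring is a module over itself; its ideals are the submodules,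
  \<open>ideal.subspace\<close>, and \<open>ideal.span S\<close> is the ideal generated by \<open>S\<close>.\<close>

global_interpretation ideal: module "(*) :: 'a::comm_ring_1 \<Rightarrow> 'a \<Rightarrow> 'a"
  by unfold_locales (simp_all add: algebra_simps)

definition prime_ideal :: "'a::comm_ring_1 set \<Rightarrow> bool" where
  "prime_ideal P \<longleftrightarrow> ideal.subspace P \<and> P \<noteq> UNIV \<and>
     (\<forall>a b. a * b \<in> P \<longrightarrow> a \<in> P \<or> b \<in> P)"

definition height :: "'a::comm_ring_1 set \<Rightarrow> enat" where
  "height P = Sup {enat l | l. \<exists>C. (\<forall>i\<le>l. prime_ideal (C i)) \<and>
     (\<forall>i<l. C i \<subset> C (Suc i)) \<and> C l = P}"

text \<open>\<open>Ass(R/J)\<close>: the prime ideals that are annihilators of elements of \<open>R/J\<close>; the class of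
  \<open>a\<close> has annihilator \<open>{r. r * a \<in> J}\<close>.\<close>

definition associated_primes :: "'a::comm_ring_1 set \<Rightarrow> 'a set set" where
  "associated_primes J = {P. prime_ideal P \<and> (\<exists>a. P = {r. r * a \<in> J})}"

text \<open>The localization \<open>(R/J)\<^sub>P\<close> is the set of fractions \<open>a/s\<close> with \<open>a\<close> in \<open>R/J\<close> (given by a
  representative in \<open>R\<close>) and \<open>s \<notin> P\<close>, where \<open>a/s = b/t\<close> iff some \<open>u \<notin> P\<close> kills \<open>t a - s b\<close>
  in \<open>R/J\<close>.\<close>

definition loc_rel :: "'a::comm_ring_1 set \<Rightarrow> 'a set \<Rightarrow> (('a \<times> 'a) \<times> ('a \<times> 'a)) set" where
  "loc_rel J P = {((a, s), (b, t)). s \<notin> P \<and> t \<notin> P \<and> (\<exists>u. u \<notin> P \<and> u * (t * a - s * b) \<in> J)}"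

definition localization :: "'a::comm_ring_1 set \<Rightarrow> 'a set \<Rightarrow> ('a \<times> 'a) set set" where
  "localization J P = (UNIV \<times> (- P)) // loc_rel J P"

definition loc_frac :: "'a::comm_ring_1 set \<Rightarrow> 'a set \<Rightarrow> 'a \<Rightarrow> 'a \<Rightarrow> ('a \<times> 'a) set" where
  "loc_frac J P a s = loc_rel J P `` {(a, s)}"

text \<open>\<open>R\<^sub>P\<close>-submodules of \<open>(R/J)\<^sub>P\<close>; the scalar \<open>r/u\<close> of \<open>R\<^sub>P\<close> (so \<open>u \<notin> P\<close>) sends \<open>a/s\<close>
  to \<open>(r a)/(u s)\<close>.\<close>

definition loc_submodule :: "'a::comm_ring_1 set \<Rightarrow> 'a set \<Rightarrow> ('a \<times> 'a) set set \<Rightarrow> bool" where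
  "loc_submodule J P N \<longleftrightarrow> N \<subseteq> localization J P \<and> loc_frac J P 0 1 \<in> N \<and>
     (\<forall>a s b t. s \<notin> P \<longrightarrow> t \<notin> P \<longrightarrow> loc_frac J P a s \<in> N \<longrightarrow> loc_frac J P b t \<in> N \<longrightarrow>
        loc_frac J P (t * a + s * b) (s * t) \<in> N) \<and>
     (\<forall>r u a s. u \<notin> P \<longrightarrow> s \<notin> P \<longrightarrow> loc_frac J P a s \<in> N \<longrightarrow>
        loc_frac J P (r * a) (u * s) \<in> N)"

definition local_length :: "'a::comm_ring_1 set \<Rightarrow> 'a set \<Rightarrow> enat" where
  "local_length J P = Sup {enat l | l. \<exists>C. (\<forall>i\<le>l. loc_submodule J P (C i)) \<and>
     (\<forall>i<l. C i \<subset> C (Suc i))}"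


section \<open>The graded polynomial ring\<close>

text \<open>\<open>k[x\<^sub>1,\<dots>,x\<^sub>n]\<close> with the variables indexed by a finite type with \<open>n\<close> elements: finitely
  supported maps from exponent vectors to coefficients, with the convolution product.\<close>

type_synonym ('n, 'k) mpoly = "('n \<Rightarrow>\<^sub>0 nat) \<Rightarrow>\<^sub>0 'k"

definition mdeg :: "('n::finite \<Rightarrow>\<^sub>0 nat) \<Rightarrow> nat" where
  "mdeg u = (\<Sum>i\<in>UNIV. Poly_Mapping.lookup u i)"

text \<open>The homogeneous component of degree \<open>m\<close>, including \<open>0\<close>; it is \<open>{0}\<close> for negative \<open>m\<close>.\<close>

definition forms :: "int \<Rightarrow> ('n::finite, 'k::field) mpoly set" where
  "forms m = {p. \<forall>u\<in>Poly_Mapping.keys p. int (mdeg u) = m}"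

definition mscale :: "'k::field \<Rightarrow> ('n, 'k) mpoly \<Rightarrow> ('n, 'k) mpoly" where
  "mscale c p = Poly_Mapping.single 0 c * p"

global_interpretation mpoly: vector_space "mscale :: 'k::field \<Rightarrow> ('n, 'k) mpoly \<Rightarrow> _"
proof
  fix a b :: 'k and x y :: "('n, 'k) mpoly"
  show "mscale a (x + y) = mscale a x + mscale a y"
    by (simp add: mscale_def algebra_simps)
  show "mscale (a + b) x = mscale a x + mscale b x"
    by (simp add: mscale_def single_add algebra_simps)
  show "mscale a (mscale b x) = mscale (a * b) x"
    by (simp add: mscale_def mult_single flip: mult.assoc)
  show "mscale 1 x = x"
    by (simp add: mscale_def)
qed

text \<open>\<open>dim\<^sub>k (R/I)\<^sub>m\<close> for a homogeneous ideal \<open>I\<close>; all spaces involved are finite-dimensional.\<close>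

definition hilbert_function :: "('n::finite, 'k::field) mpoly set \<Rightarrow> nat \<Rightarrow> nat" where
  "hilbert_function I m = mpoly.dim (forms (int m) :: ('n, 'k) mpoly set)
                        - mpoly.dim (I \<inter> forms (int m))"

definition hilbert_polynomial :: "('n::finite, 'k::field) mpoly set \<Rightarrow> rat poly" where
  "hilbert_polynomial I =
     (THE H. \<forall>\<^sub>F m in sequentially. poly H (of_nat m) = of_nat (hilbert_function I m))"

text \<open>The degree (multiplicity) of \<open>R/I\<close> when \<open>R/I\<close> has positive Krull dimension, in which case
  the Hilbert polynomial is nonzero of degree \<open>dim R/I - 1\<close>. Below it is used for primes of height
  two in at least three variables only.\<close>

definition hilbert_degree :: "('n::finite, 'k::field) mpoly set \<Rightarrow> rat" where
  "hilbert_degree I =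
     fact (degree (hilbert_polynomial I)) * lead_coeff (hilbert_polynomial I)"

text \<open>\<open>deg(R/J)\<close> in codimension two. If \<open>J\<close> has height at least two, as every ideal with a degree
  vector does, then the primes summed over are minimal over \<open>J\<close> and the local lengths are
  finite, so that \<open>the_enat\<close> is applied to finite values.\<close>

definition codim2_degree :: "('n::finite, 'k::field) mpoly set \<Rightarrow> rat" where
  "codim2_degree J = (\<Sum>P \<in> {P \<in> associated_primes J. height P = 2}.
     of_nat (the_enat (local_length J P)) * hilbert_degree P)"


section \<open>Ideals with a degree vector\<close>

text \<open>\<open>J\<close> is an ideal with degree vector \<open>(d\<^sub>1,d\<^sub>2,d\<^sub>3)\<close>, minimally generated by
  \<open>f\<^sub>1\<close>, \<open>f\<^sub>2\<close>, \<open>f\<^sub>3\<close>. The last clause is \<open>gcd(f\<^sub>1,f\<^sub>2,f\<^sub>3) = 1\<close>.\<close>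

definition has_degree_vector ::
  "nat \<Rightarrow> nat \<Rightarrow> nat \<Rightarrow> ('n::finite, 'k::field) mpoly \<Rightarrow> ('n, 'k) mpoly \<Rightarrow> ('n, 'k) mpoly \<Rightarrow>
   ('n, 'k) mpoly set \<Rightarrow> bool" where
  "has_degree_vector d1 d2 d3 f1 f2 f3 J \<longleftrightarrow>
     1 \<le> d1 \<and> d1 \<le> d2 \<and> d2 \<le> d3 \<and>
     f1 \<noteq> 0 \<and> f2 \<noteq> 0 \<and> f3 \<noteq> 0 \<and>
     f1 \<in> forms (int d1) \<and> f2 \<in> forms (int d2) \<and> f3 \<in> forms (int d3) \<and>
     J = ideal.span {f1, f2, f3} \<and>
     J \<noteq> ideal.span {f2, f3} \<and> J \<noteq> ideal.span {f1, f3} \<and> J \<noteq> ideal.span {f1, f2} \<and>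
     (\<forall>g. g dvd f1 \<and> g dvd f2 \<and> g dvd f3 \<longrightarrow> g dvd 1)"

text \<open>The component of \<open>Syz(J)\<close> of shifted degree \<open>q\<close>. As a graded module, \<open>Syz(J)\<close> depends
  on the minimal generators only up to isomorphism.\<close>

definition syz ::
  "nat \<Rightarrow> nat \<Rightarrow> nat \<Rightarrow> ('n::finite, 'k::field) mpoly \<Rightarrow> ('n, 'k) mpoly \<Rightarrow> ('n, 'k) mpoly \<Rightarrow>
   int \<Rightarrow> (('n, 'k) mpoly \<times> ('n, 'k) mpoly \<times> ('n, 'k) mpoly) set" where
  "syz d1 d2 d3 f1 f2 f3 q = {(a1, a2, a3). a1 * f1 + a2 * f2 + a3 * f3 = 0 \<and>
     a1 \<in> forms (q - int d1) \<and> a2 \<in> forms (q - int d2) \<and> a3 \<in> forms (q - int d3)}"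

definition indeg_syz ::
  "nat \<Rightarrow> nat \<Rightarrow> nat \<Rightarrow> ('n::finite, 'k::field) mpoly \<Rightarrow> ('n, 'k) mpoly \<Rightarrow> ('n, 'k) mpoly \<Rightarrow>
   int" where
  "indeg_syz d1 d2 d3 f1 f2 f3 = (LEAST q. syz d1 d2 d3 f1 f2 f3 q \<noteq> {(0, 0, 0)})"


section \<open>Admissible and realizable pairs\<close>

definition dsum :: "nat \<Rightarrow> nat \<Rightarrow> nat \<Rightarrow> int" where
  "dsum d1 d2 d3 = int d1 + int d2 + int d3"

definition dsigma :: "nat \<Rightarrow> nat \<Rightarrow> nat \<Rightarrow> int" where
  "dsigma d1 d2 d3 = int d1 * int d2 + int d1 * int d3 + int d2 * int d3"

definition Fd :: "nat \<Rightarrow> nat \<Rightarrow> nat \<Rightarrow> int \<Rightarrow> int" where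
  "Fd d1 d2 d3 e = e^2 - e * dsum d1 d2 d3 + dsigma d1 d2 d3"

definition degree_interval :: "int \<Rightarrow> nat \<Rightarrow> nat \<Rightarrow> nat \<Rightarrow> int set" where
  "degree_interval e d1 d2 d3 =
     {max (dsigma d1 d2 d3 - e * dsum d1 d2 d3) 0 .. Fd d1 d2 d3 e}"

definition admissible :: "nat \<Rightarrow> nat \<Rightarrow> nat \<Rightarrow> int \<Rightarrow> int \<Rightarrow> bool" where
  "admissible d1 d2 d3 e j \<longleftrightarrow>
     int d2 < e \<and> e \<le> int d1 + int d2 \<and> j \<in> degree_interval e d1 d2 d3"

definition realizable ::
  "'n::finite itself \<Rightarrow> 'k::field itself \<Rightarrow> nat \<Rightarrow> nat \<Rightarrow> nat \<Rightarrow> int \<Rightarrow> int \<Rightarrow> bool" where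
  "realizable _ _ d1 d2 d3 e j \<longleftrightarrow>
     (\<exists>(f1 :: ('n, 'k) mpoly) f2 f3 J. has_degree_vector d1 d2 d3 f1 f2 f3 J \<and>
        indeg_syz d1 d2 d3 f1 f2 f3 = e \<and> codim2_degree J = of_int j)"

end

theory Submission
  imports Defs
begin

text \<open>A syzygy of degree at most \<open>d\<^sub>2\<close> has constant coefficients at \<open>f\<^sub>2\<close> and \<open>f\<^sub>3\<close>, which contradicts
  minimality, while \<open>(f\<^sub>2, - f\<^sub>1, 0)\<close> has degree \<open>d\<^sub>2 + 1\<close>. For the degrees, reduce modulo the linear
  form \<open>f\<^sub>1\<close>: by unique factorization a height two prime associated to \<open>J\<close> has the form \<open>(f\<^sub>1, p)\<close>
  with \<open>p\<close> an irreducible common factor of the residues of \<open>f\<^sub>2\<close> and \<open>f\<^sub>3\<close>; its contribution is the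
  multiplicity of \<open>p\<close> in their gcd times the degree of \<open>p\<close>. So \<open>deg(R/J)\<close> is at most the degree of
  that gcd, and it can only be \<open>d\<^sub>2\<close> if the residue of \<open>f\<^sub>2\<close> divides that of \<open>f\<^sub>3\<close>, against minimality.
  The value \<open>j < d\<^sub>2\<close> is attained by the ideal \<open>(x, y\<^sup>a, y\<^sup>j z\<^sup>b)\<close> with \<open>a = d\<^sub>2\<close> and \<open>b = d\<^sub>3 - j\<close>.\<close>

text \<open>Read on ring multiplication, this simplification rule is associativity oriented against
  \<open>algebra_simps\<close>, which makes the simplifier loop.\<close>

declare ideal.scale_scale [simp del]

section \<open>Supports, leading coefficients and degrees\<close>

text \<open>The quotient by \<open>f\<^sub>1\<close> is never formed. A variable
  \<open>x\<^sub>i\<close> occurring in \<open>f\<^sub>1\<close> is eliminated, and residues are the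
  polynomials free of \<open>x\<^sub>i\<close> inside the same ring. Statements on ideals containing
  \<open>f\<^sub>1\<close> thereby become statements on divisibility of such residues, and unique
  factorization is obtained from Gauss's lemma, adding one variable at a time. The delicate point is
  the height, a supremum over all chains of primes. Excluding the degree \<open>d\<^sub>2\<close>
  only takes lower bounds: a prime strictly above \<open>(l, p)\<close> has height at least three
  because of the chain \<open>0\<close>, \<open>(l)\<close>, \<open>(l, p)\<close>. An upper bound
  is established only for the ideal \<open>(x, y)\<close> of the example, by eliminating a variable
  from two coprime elements. In the same way, upper bounds on the local lengths suffice to exclude
  \<open>d\<^sub>2\<close>, while the example takes their exact values. Since the admissible values
  are \<open>0..d\<^sub>2\<close>, the converse direction amounts to refuting equality with
  \<open>d\<^sub>2\<close>.\<close>

abbreviation keys where "keys \<equiv> Poly_Mapping.keys"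
abbreviation lookup where "lookup \<equiv> Poly_Mapping.lookup"

text \<open>Being free of variables, bounded in one variable, or homogeneous are all conditions on
  the exponents that occur, so the closure properties are proved once for an arbitrary set of
  exponents.\<close>

definition supported :: "('n \<Rightarrow>\<^sub>0 nat) set \<Rightarrow> ('n, 'k::field) mpoly set" where
  "supported U = {p. keys p \<subseteq> U}"

definition polys_in :: "'n set \<Rightarrow> ('n, 'k::field) mpoly set" where
  "polys_in A = supported {u. keys u \<subseteq> A}"

text \<open>The strict bound makes \<open>0\<close> the only polynomial with bound \<open>0\<close>,
  so no convention for the degree of zero is required.\<close>

definition xdeg_less :: "'n \<Rightarrow> nat \<Rightarrow> ('n, 'k::field) mpoly set" where
  "xdeg_less i d = supported {u. lookup u i < d}"

definition var :: "'n \<Rightarrow> ('n, 'k::field) mpoly" where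
  "var i = Poly_Mapping.single (Poly_Mapping.single i 1) 1"

definition const :: "'k \<Rightarrow> ('n, 'k::field) mpoly" where
  "const c = Poly_Mapping.single 0 c"

lemma supported_0 [simp]: "0 \<in> supported U"
  by (simp add: supported_def)

lemma supported_add: "p \<in> supported U \<Longrightarrow> q \<in> supported U \<Longrightarrow> p + q \<in> supported U"
  using keys_add[of p q] by (auto simp: supported_def)

lemma supported_uminus: "p \<in> supported U \<Longrightarrow> - p \<in> supported U"
  by (auto simp: supported_def in_keys_iff)

lemma supported_diff: "p \<in> supported U \<Longrightarrow> q \<in> supported U \<Longrightarrow> p - q \<in> supported U"
  using supported_add[of p U "- q"] supported_uminus[of q U] by simp

lemma supported_sum: "(\<And>x. x \<in> S \<Longrightarrow> f x \<in> supported U) \<Longrightarrow> sum f S \<in> supported U"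
  by (induction S rule: infinite_finite_induct) (auto intro: supported_add)

lemma supported_mono: "U \<subseteq> W \<Longrightarrow> supported U \<subseteq> supported W"
  by (auto simp: supported_def)

lemma supported_mult:
  assumes "p \<in> supported U" "q \<in> supported W" "\<And>u w. u \<in> U \<Longrightarrow> w \<in> W \<Longrightarrow> u + w \<in> Z"
  shows "p * q \<in> supported Z"
  using keys_mult[of p q] assms by (fastforce simp: supported_def)

lemma sum_single_lookup:
  assumes "finite S" "keys p \<subseteq> S"
  shows "p = (\<Sum>u\<in>S. Poly_Mapping.single u (lookup p u))"
proof (rule poly_mapping_eqI)
  fix k
  have "(\<Sum>u\<in>S. lookup (Poly_Mapping.single u (lookup p u)) k) = (\<Sum>u\<in>S. if u = k then lookup p k else 0)"
    by (intro sum.cong) (auto simp: lookup_single when_def)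
  also have "\<dots> = lookup p k"
    using assms by (auto simp: in_keys_iff)
  finally show "lookup p k = lookup (\<Sum>u\<in>S. Poly_Mapping.single u (lookup p u)) k"
    unfolding lookup_sum ..
qed

lemma supported_split:
  assumes "p \<in> supported Z"
  obtains a b where "p = a + b" "a \<in> supported (Z \<inter> U)" "b \<in> supported (Z - U)"
proof
  let ?s = "\<lambda>u. Poly_Mapping.single u (lookup p u)"
  have "p = sum ?s (keys p)" by (rule sum_single_lookup[OF finite_keys subset_refl])
  also have "\<dots> = sum ?s (keys p \<inter> U) + sum ?s (keys p - U)"
    by (rule sum.Int_Diff) simp
  finally show "p = sum ?s (keys p \<inter> U) + sum ?s (keys p - U)" .
  show "sum ?s (keys p \<inter> U) \<in> supported (Z \<inter> U)"
    using assms by (intro supported_sum) (auto simp: supported_def)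
  show "sum ?s (keys p - U) \<in> supported (Z - U)"
    using assms by (intro supported_sum) (auto simp: supported_def)
qed

lemma lookup_mult_monomial:
  fixes p :: "('n, 'k::field) mpoly"
  shows "lookup (p * Poly_Mapping.single v c) (u + v) = lookup p u * c"
proof -
  let ?s = "\<lambda>w. Poly_Mapping.single w (lookup p w)"
  \<comment> \<open>Inserting \<open>u\<close> makes its coefficient a term of the sum even when
    that coefficient is zero.\<close>
  let ?S = "insert u (keys p)"
  have "p * Poly_Mapping.single v c = (\<Sum>w\<in>?S. ?s w) * Poly_Mapping.single v c"
    by (subst sum_single_lookup[of ?S p]) auto
  also have "\<dots> = (\<Sum>w\<in>?S. Poly_Mapping.single (w + v) (lookup p w * c))"
    unfolding sum_distrib_right mult_single ..
  finally have "lookup (p * Poly_Mapping.single v c) (u + v)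
      = (\<Sum>w\<in>?S. if w = u then lookup p u * c else 0)"
    by (simp only: lookup_sum) (intro sum.cong, auto simp: lookup_single when_def)
  then show ?thesis by simp
qed

lemma supported_div_monomial:
  fixes p :: "('n, 'k::field) mpoly"
  assumes "p \<in> supported U" "\<And>u. u \<in> U \<Longrightarrow> \<exists>w \<in> W. u = w + v"
  obtains l where "l \<in> supported W" "p = l * Poly_Mapping.single v 1"
proof -
  define g where "g u = (SOME w. w \<in> W \<and> u = w + v)" for u
  have g: "g u \<in> W" "u = g u + v" if "u \<in> keys p" for u
  proof -
    have "\<exists>w. w \<in> W \<and> u = w + v" using that assms by (auto simp: supported_def)
    from someI_ex[OF this] show "g u \<in> W" "u = g u + v" by (auto simp: g_def)
  qed
  let ?l = "\<Sum>u\<in>keys p. Poly_Mapping.single (g u) (lookup p u)"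
  have "?l * Poly_Mapping.single v 1 = (\<Sum>u\<in>keys p. Poly_Mapping.single (g u + v) (lookup p u))"
    by (simp add: sum_distrib_right mult_single)
  also have "\<dots> = (\<Sum>u\<in>keys p. Poly_Mapping.single u (lookup p u))"
    using g(2) by (intro sum.cong) auto
  also have "\<dots> = p" by (rule sum_single_lookup[OF finite_keys subset_refl, symmetric])
  finally have "p = ?l * Poly_Mapping.single v 1" ..
  moreover have "?l \<in> supported W"
    using g(1) by (intro supported_sum) (auto simp: supported_def)
  ultimately show ?thesis using that by blast
qed

lemma var_power: "var i ^ d = Poly_Mapping.single (Poly_Mapping.single i d) 1"
  by (induction d) (auto simp: var_def mult_single simp flip: single_add)

lemma keys_add_nat: "keys (u + v) = keys u \<union> keys (v :: 'n \<Rightarrow>\<^sub>0 nat)"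
  by (auto simp: in_keys_iff lookup_add)

lemma polys_in_0 [simp]: "0 \<in> polys_in A"
  by (simp add: polys_in_def)

lemma polys_in_1 [simp]: "1 \<in> polys_in A"
  by (simp add: polys_in_def supported_def)

lemma polys_in_const [simp]: "const c \<in> polys_in A"
  by (simp add: polys_in_def supported_def const_def)

lemma polys_in_add: "p \<in> polys_in A \<Longrightarrow> q \<in> polys_in A \<Longrightarrow> p + q \<in> polys_in A"
  by (simp add: polys_in_def supported_add)

lemma polys_in_diff: "p \<in> polys_in A \<Longrightarrow> q \<in> polys_in A \<Longrightarrow> p - q \<in> polys_in A"
  by (simp add: polys_in_def supported_diff)

lemma polys_in_uminus: "p \<in> polys_in A \<Longrightarrow> - p \<in> polys_in A"
  by (simp add: polys_in_def supported_uminus)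

lemma polys_in_mult: "p \<in> polys_in A \<Longrightarrow> q \<in> polys_in A \<Longrightarrow> p * q \<in> polys_in A"
  unfolding polys_in_def by (rule supported_mult) (auto simp: keys_add_nat)

lemma polys_in_power: "p \<in> polys_in A \<Longrightarrow> p ^ k \<in> polys_in A"
  by (induction k) (auto intro: polys_in_mult)

lemma polys_in_var [simp]: "var i \<in> polys_in A \<longleftrightarrow> i \<in> A"
  by (auto simp: var_def polys_in_def supported_def)

lemma polys_in_mono: "A \<subseteq> B \<Longrightarrow> polys_in A \<subseteq> polys_in B"
  unfolding polys_in_def by (rule supported_mono) auto

lemma polys_in_UNIV [simp]: "polys_in UNIV = UNIV"
  by (simp add: polys_in_def supported_def)

lemma polys_in_empty:
  assumes "p \<in> polys_in {}" obtains c where "p = const c"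
proof
  have "keys p \<subseteq> {0}" using assms by (auto simp: polys_in_def supported_def)
  then show "p = const (lookup p 0)"
    unfolding const_def using sum_single_lookup[of "{0}" p] by simp
qed

lemmas polys_in_closed = polys_in_add polys_in_diff polys_in_uminus polys_in_mult polys_in_power

section \<open>Degree and leading coefficient in one variable\<close>

lemma xdeg_less_0 [simp]: "0 \<in> xdeg_less i d"
  by (simp add: xdeg_less_def)

lemma xdeg_less_zero_iff: "p \<in> xdeg_less i 0 \<longleftrightarrow> p = 0"
  by (auto simp: xdeg_less_def supported_def)

lemma xdeg_less_add: "p \<in> xdeg_less i d \<Longrightarrow> q \<in> xdeg_less i d \<Longrightarrow> p + q \<in> xdeg_less i d"
  by (simp add: xdeg_less_def supported_add)

lemma xdeg_less_diff: "p \<in> xdeg_less i d \<Longrightarrow> q \<in> xdeg_less i d \<Longrightarrow> p - q \<in> xdeg_less i d"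
  by (simp add: xdeg_less_def supported_diff)

lemma xdeg_less_uminus: "p \<in> xdeg_less i d \<Longrightarrow> - p \<in> xdeg_less i d"
  by (simp add: xdeg_less_def supported_uminus)

lemma xdeg_less_mono: "d \<le> e \<Longrightarrow> p \<in> xdeg_less i d \<Longrightarrow> p \<in> xdeg_less i e"
  by (auto simp: xdeg_less_def supported_def)

text \<open>A strict bound \<open>d\<close> and a weak bound \<open>e\<close>, written as
  \<open>Suc e\<close>, add up to the strict bound \<open>d + e\<close>; the asymmetric form avoids
  subtracting one.\<close>

lemma xdeg_less_mult:
  "p \<in> xdeg_less i d \<Longrightarrow> q \<in> xdeg_less i (Suc e) \<Longrightarrow> p * q \<in> xdeg_less i (d + e)"
  unfolding xdeg_less_def by (rule supported_mult) (auto simp: lookup_add)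

lemma xdeg_less_1_iff: "p \<in> xdeg_less i 1 \<longleftrightarrow> p \<in> polys_in (- {i})"
proof -
  have "lookup u i < 1 \<longleftrightarrow> keys u \<subseteq> - {i}" for u :: "'a \<Rightarrow>\<^sub>0 nat"
    by (auto simp: in_keys_iff)
  then show ?thesis by (simp add: xdeg_less_def polys_in_def)
qed

lemma var_power_xdeg: "var i ^ d \<in> xdeg_less i (Suc d)"
  by (simp add: var_power xdeg_less_def supported_def)

lemma xdeg_less_exists: "\<exists>d. p \<in> xdeg_less i d"
proof -
  have "lookup u i < Suc (Max ((\<lambda>u. lookup u i) ` keys p))" if "u \<in> keys p" for u
    using that by (simp add: less_Suc_eq_le)
  then show ?thesis by (auto simp: xdeg_less_def supported_def intro!: exI)
qed

lemma xdeg_less_mult_polys_in: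
  assumes "l \<in> polys_in (- {i})" "q \<in> xdeg_less i d"
  shows "l * q \<in> xdeg_less i d"
proof (cases d)
  case 0
  then show ?thesis using assms by (simp add: xdeg_less_zero_iff)
next
  case (Suc e)
  have "l \<in> xdeg_less i 1" using assms(1) by (rule xdeg_less_1_iff[THEN iffD2])
  from xdeg_less_mult[OF this assms(2)[unfolded Suc]] show ?thesis unfolding Suc plus_1_eq_Suc .
qed

lemma xdeg_less_mult_var_power:
  assumes "q \<in> xdeg_less i d" shows "q * var i ^ e \<in> xdeg_less i (d + e)"
  using xdeg_less_mult[OF assms var_power_xdeg] .

text \<open>This views \<open>g\<close> as a polynomial in \<open>x\<^sub>i\<close> over the
  coefficient ring \<open>polys_in A\<close>. The coefficient \<open>l\<close> may vanish, since
  \<open>Suc d\<close> is only an upper bound.\<close>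

lemma xdeg_leading_coeff:
  assumes "g \<in> polys_in (insert i A)" "g \<in> xdeg_less i (Suc d)" "i \<notin> A"
  obtains l g' where "l \<in> polys_in A" "g = l * var i ^ d + g'"
    "g' \<in> xdeg_less i d" "g' \<in> polys_in (insert i A)"
proof -
  let ?Z = "{u. keys u \<subseteq> insert i A} \<inter> {u. lookup u i < Suc d}"
  have "g \<in> supported ?Z"
    using assms by (auto simp: polys_in_def xdeg_less_def supported_def)
  then obtain a b where ab: "g = a + b" "a \<in> supported (?Z \<inter> {u. lookup u i = d})"
      "b \<in> supported (?Z - {u. lookup u i = d})"
    by (rule supported_split)
  have "\<exists>w\<in>{u. keys u \<subseteq> A}. u = w + Poly_Mapping.single i d"
    if u: "u \<in> ?Z \<inter> {u. lookup u i = d}" for u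
  proof -
    have "u = (u - Poly_Mapping.single i d) + Poly_Mapping.single i d"
      using u by (intro poly_mapping_eqI) (auto simp: lookup_add lookup_minus lookup_single when_def)
    moreover have "keys (u - Poly_Mapping.single i d) \<subseteq> A"
      using u assms(3) by (auto simp: subset_eq in_keys_iff lookup_minus lookup_single when_def split: if_splits)
    ultimately show ?thesis by blast
  qed
  with ab(2) obtain l where l: "l \<in> supported {u. keys u \<subseteq> A}"
      "a = l * Poly_Mapping.single (Poly_Mapping.single i d) 1"
    by (rule supported_div_monomial)
  have "b \<in> xdeg_less i d" "b \<in> polys_in (insert i A)"
    using ab(3) unfolding polys_in_def xdeg_less_def supported_def by fastforce+
  with l ab(1) show ?thesis
    by (intro that[of l b]) (auto simp: polys_in_def var_power)
qed

lemma xdeg_lead_eq_0: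
  assumes "l * var i ^ d \<in> xdeg_less i d" shows "l = 0"
proof (rule ccontr)
  assume "l \<noteq> 0"
  then obtain u where u: "u \<in> keys l" by (meson all_not_in_conv keys_eq_empty)
  then have "u + Poly_Mapping.single i d \<in> keys (l * var i ^ d)"
    by (simp add: in_keys_iff var_power lookup_mult_monomial)
  with assms have "lookup (u + Poly_Mapping.single i d) i < d"
    by (auto simp: xdeg_less_def supported_def)
  then show False by (simp add: lookup_add)
qed

lemma xdeg_lead_cases:
  assumes "g \<in> polys_in (insert i A)" "i \<notin> A" "g \<noteq> 0"
  obtains d l g' where "l \<in> polys_in A" "l \<noteq> 0" "g = l * var i ^ d + g'"
    "g' \<in> xdeg_less i d" "g' \<in> polys_in (insert i A)"
proof -
  \<comment> \<open>The least strict bound is the degree plus one, and its minimality is what makes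
    the leading coefficient nonzero.\<close>
  define D where "D = (LEAST D. g \<in> xdeg_less i D)"
  have D: "g \<in> xdeg_less i D" unfolding D_def using xdeg_less_exists by (rule LeastI_ex)
  have D': "g \<notin> xdeg_less i d" if "d < D" for d
    using not_less_Least that D_def by blast
  have "D \<noteq> 0" using D assms(3) by (metis xdeg_less_zero_iff)
  then obtain d where d: "D = Suc d" using not0_implies_Suc by blast
  obtain l g' where "l \<in> polys_in A" "g = l * var i ^ d + g'"
    "g' \<in> xdeg_less i d" "g' \<in> polys_in (insert i A)"
    using xdeg_leading_coeff[OF assms(1) D[unfolded d] assms(2)] .
  moreover have "l \<noteq> 0"
  proof
    assume "l = 0"
    with calculation have "g \<in> xdeg_less i d" by simp
    with D' d show False by simp
  qed
  ultimately show ?thesis using that by blast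
qed

lemma mult_leading:
  assumes "a = l * var i ^ d + a'" "b = m * var i ^ e + b'" "a' \<in> xdeg_less i d" "b' \<in> xdeg_less i e"
    "l \<in> polys_in (- {i})" "m \<in> polys_in (- {i})"
  shows "\<exists>r. a * b = (l * m) * var i ^ (d + e) + r \<and> r \<in> xdeg_less i (d + e)"
proof (intro exI conjI)
  let ?r = "l * var i ^ d * b' + m * var i ^ e * a' + a' * b'"
  show "a * b = (l * m) * var i ^ (d + e) + ?r"
    by (simp add: assms(1,2) algebra_simps power_add)
  have "l * (b' * var i ^ d) \<in> xdeg_less i (e + d)" "m * (a' * var i ^ e) \<in> xdeg_less i (d + e)"
    using assms by (auto intro!: xdeg_less_mult_polys_in xdeg_less_mult_var_power)
  moreover have "a' * b' \<in> xdeg_less i (d + e)"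
    using assms by (intro xdeg_less_mult) (auto intro: xdeg_less_mono[rotated])
  ultimately show "?r \<in> xdeg_less i (d + e)"
    by (intro xdeg_less_add) (simp_all add: ac_simps)
qed

text \<open>Induction on the number of variables: if two nonzero polynomials had product zero, then
  so would their leading coefficients in the last variable.\<close>

lemma polys_in_no_zero_divisors:
  assumes "finite A"
  shows "a \<in> polys_in A \<Longrightarrow> b \<in> polys_in A \<Longrightarrow> a * b = 0 \<Longrightarrow> a = 0 \<or> b = 0"
  using assms
proof (induction A arbitrary: a b)
  case empty
  then obtain c d where "a = const c" "b = const d" by (metis polys_in_empty)
  with empty show ?case by (auto simp: const_def mult_single) (metis lookup_single_eq lookup_zero mult_eq_0_iff single_zero)
next
  case (insert i A)
  show ?case
  proof (rule ccontr)
    assume "\<not> (a = 0 \<or> b = 0)"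
    then obtain d l a' e m b' where *: "l \<in> polys_in A" "l \<noteq> 0" "a = l * var i ^ d + a'"
      "a' \<in> xdeg_less i d" "m \<in> polys_in A" "m \<noteq> 0" "b = m * var i ^ e + b'" "b' \<in> xdeg_less i e"
      using xdeg_lead_cases[OF insert.prems(1) insert.hyps(2)]
        xdeg_lead_cases[OF insert.prems(2) insert.hyps(2)] by metis
    have A: "polys_in A \<subseteq> polys_in (- {i})" using insert.hyps by (intro polys_in_mono) auto
    obtain r where "a * b = (l * m) * var i ^ (d + e) + r" "r \<in> xdeg_less i (d + e)"
      using mult_leading[OF *(3,7,4,8)] * A by blast
    then have "(l * m) * var i ^ (d + e) = - r" "- r \<in> xdeg_less i (d + e)"
      using insert.prems by (auto simp: eq_neg_iff_add_eq_0 xdeg_less_uminus)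
    then have "l * m = 0" using xdeg_lead_eq_0 by metis
    with insert.IH * show False by blast
  qed
qed

lemma mpoly_mult_eq_0_iff [simp]:
  fixes a b :: "('n::finite, 'k::field) mpoly"
  shows "a * b = 0 \<longleftrightarrow> a = 0 \<or> b = 0"
  using polys_in_no_zero_divisors[of "UNIV :: 'n set" a b] by auto

lemma mpoly_mult_left_cancel:
  fixes a b c :: "('n::finite, 'k::field) mpoly"
  assumes "a \<noteq> 0" shows "a * b = a * c \<longleftrightarrow> b = c"
proof -
  have "a * b = a * c \<longleftrightarrow> a * (b - c) = 0" by (simp only: right_diff_distrib right_minus_eq)
  also have "\<dots> \<longleftrightarrow> b = c" using assms by (simp only: mpoly_mult_eq_0_iff right_minus_eq) simp
  finally show ?thesis .
qed

lemma mpoly_dvd_mult_cancel_left: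
  fixes a b c :: "('n::finite, 'k::field) mpoly"
  assumes "a \<noteq> 0" shows "a * b dvd a * c \<longleftrightarrow> b dvd c"
  by (auto simp: dvd_def mult.assoc mpoly_mult_left_cancel[OF assms])

lemma mpoly_power_eq_0_iff [simp]:
  fixes a :: "('n::finite, 'k::field) mpoly"
  shows "a ^ k = 0 \<longleftrightarrow> a = 0 \<and> k > 0"
  by (induction k) auto

lemma polys_in_Inter: "p \<in> polys_in A \<longleftrightarrow> (\<forall>i. i \<notin> A \<longrightarrow> p \<in> polys_in (- {i}))"
  by (auto simp: polys_in_def supported_def subset_eq)

text \<open>In a domain the degrees in each \<open>x\<^sub>i\<close> add up, so a nonzero product
  free of \<open>x\<^sub>i\<close> has both factors free of it. This keeps the factors of residues
  inside the residue ring.\<close>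

lemma polys_in_factor:
  fixes a b :: "('n::finite, 'k::field) mpoly"
  assumes "a * b \<in> polys_in A" "a * b \<noteq> 0"
  shows "a \<in> polys_in A"
proof -
  have "a \<in> polys_in (- {i})" if "i \<notin> A" for i
  proof -
    have [simp]: "insert i (- {i}) = UNIV" by auto
    have ab0: "a \<noteq> 0" "b \<noteq> 0" using assms(2) by auto
    obtain d l a' where a: "l \<in> polys_in (- {i})" "l \<noteq> 0" "a = l * var i ^ d + a'" "a' \<in> xdeg_less i d"
      by (rule xdeg_lead_cases[of a i "- {i}"]) (use ab0 in auto)
    obtain e m b' where b: "m \<in> polys_in (- {i})" "m \<noteq> 0" "b = m * var i ^ e + b'" "b' \<in> xdeg_less i e"
      by (rule xdeg_lead_cases[of b i "- {i}"]) (use ab0 in auto)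
    obtain r where r: "a * b = (l * m) * var i ^ (d + e) + r" "r \<in> xdeg_less i (d + e)"
      using mult_leading[OF a(3) b(3) a(4) b(4) a(1) b(1)] by blast
    have "d + e = 0"
    proof (rule ccontr)
      assume *: "d + e \<noteq> 0"
      have "a * b \<in> polys_in (- {i})" using assms(1) that polys_in_Inter by blast
      then have "a * b \<in> xdeg_less i 1" by (rule xdeg_less_1_iff[THEN iffD2])
      then have "a * b \<in> xdeg_less i (d + e)" using * by (intro xdeg_less_mono[of 1 "d + e"]) auto
      then have "a * b - r \<in> xdeg_less i (d + e)" using r(2) by (rule xdeg_less_diff)
      then have "(l * m) * var i ^ (d + e) \<in> xdeg_less i (d + e)" by (simp add: r(1))
      then have "l * m = 0" by (rule xdeg_lead_eq_0)
      then show False using a(2) b(2) by simp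
    qed
    then show ?thesis using a by (simp add: xdeg_less_zero_iff)
  qed
  then show ?thesis using polys_in_Inter by blast
qed

lemma polys_in_dvd:
  fixes a b :: "('n::finite, 'k::field) mpoly"
  assumes "a dvd b" "b \<in> polys_in A" "b \<noteq> 0" shows "a \<in> polys_in A"
  using assms polys_in_factor by (metis dvdE)

section \<open>Homogeneous forms and total degree\<close>

lemma forms_supported: "forms m = supported {u. int (mdeg u) = m}"
  by (auto simp: forms_def supported_def)

lemma mdeg_add: "mdeg (u + v) = mdeg u + mdeg v"
  by (simp add: mdeg_def lookup_add sum.distrib)

lemma mdeg_0 [simp]: "mdeg 0 = 0"
  by (simp add: mdeg_def)

lemma mdeg_single [simp]: "mdeg (Poly_Mapping.single i k) = k"
  by (simp add: mdeg_def lookup_single when_def)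

lemma mdeg_eq_0_iff [simp]: "mdeg u = 0 \<longleftrightarrow> u = 0"
  by (auto simp: mdeg_def intro: poly_mapping_eqI)

lemma forms_0 [simp]: "0 \<in> forms m"
  by (simp add: forms_def)

lemma forms_add: "p \<in> forms m \<Longrightarrow> q \<in> forms m \<Longrightarrow> p + q \<in> forms m"
  by (simp add: forms_supported supported_add)

lemma forms_uminus: "p \<in> forms m \<Longrightarrow> - p \<in> forms m"
  by (simp add: forms_supported supported_uminus)

lemma forms_sum: "(\<And>x. x \<in> S \<Longrightarrow> f x \<in> forms m) \<Longrightarrow> sum f S \<in> forms m"
  by (simp add: forms_supported supported_sum)

lemma forms_mult: "p \<in> forms a \<Longrightarrow> q \<in> forms b \<Longrightarrow> p * q \<in> forms (a + b)"
  unfolding forms_supported by (rule supported_mult) (auto simp: mdeg_add)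

lemma forms_var: "var i \<in> forms 1"
  by (simp add: var_def forms_def)

lemma forms_var_power: "var i ^ d \<in> forms (int d)"
  by (simp add: var_power forms_def)

lemma forms_const: "const c \<in> forms 0"
  by (simp add: const_def forms_def)

lemma forms_neg: "p \<in> forms m \<Longrightarrow> m < 0 \<Longrightarrow> p = 0"
  by (auto simp: forms_def)

lemma forms_unique:
  assumes "p \<in> forms a" "p \<in> forms b" "p \<noteq> 0" shows "a = b"
proof -
  obtain u where "u \<in> keys p" using assms(3) by (meson all_not_in_conv keys_eq_empty)
  then show ?thesis using assms by (auto simp: forms_def)
qed

lemma forms_0_const:
  assumes "p \<in> forms 0" obtains c where "p = const c"
proof
  have "keys p \<subseteq> {0}" using assms by (auto simp: forms_def)
  then show "p = const (lookup p 0)"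
    unfolding const_def using sum_single_lookup[of "{0}" p] by simp
qed

lemma const_eq_0_iff [simp]: "const c = 0 \<longleftrightarrow> c = 0"
  unfolding const_def by (metis lookup_single_eq lookup_zero single_zero)

lemma const_0 [simp]: "const 0 = 0"
  by simp

lemma const_mult: "const a * const b = const (a * b)"
  by (simp add: const_def mult_single)

lemma const_1: "const 1 = 1"
  by (simp add: const_def)

lemma const_inverse: "c \<noteq> 0 \<Longrightarrow> const c * const (inverse c) = 1"
  by (simp add: const_mult const_1)

lemma const_dvd: "c \<noteq> 0 \<Longrightarrow> const c dvd p"
  using const_inverse by (metis dvd_triv_left dvd_mult_unit_iff' one_dvd dvd_trans)

lemma forms_part_degree:
  assumes "x \<in> forms m" "l \<in> forms (int n)" "l \<noteq> 0" "x - l \<in> supported {u. mdeg u \<noteq> n}"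
  shows "m = int n"
proof -
  obtain u where u: "u \<in> keys l" using assms(3) by (meson all_not_in_conv keys_eq_empty)
  then have n: "mdeg u = n" using assms(2) by (auto simp: forms_def)
  then have "u \<notin> keys (x - l)" using assms(4) by (auto simp: supported_def)
  then have "u \<in> keys x" using u by (auto simp: in_keys_iff lookup_minus)
  then show ?thesis using assms(1) n by (auto simp: forms_def)
qed

lemma form_part:
  fixes p :: "('n::finite, 'k::field) mpoly"
  assumes "p \<in> supported U" "u \<in> keys p"
  obtains l r where "l \<noteq> 0" "l \<in> forms (int (mdeg u))" "p = l + r" "r \<in> supported (U - {v. mdeg v = mdeg u})"
proof -
  obtain l r where lr: "p = l + r" "l \<in> supported (U \<inter> {v. mdeg v = mdeg u})"
     "r \<in> supported (U - {v. mdeg v = mdeg u})"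
    using supported_split[OF assms(1)] .
  have "u \<notin> keys r" using lr(3) by (auto simp: supported_def)
  then have "l \<noteq> 0" using assms(2) lr(1) by (auto simp: in_keys_iff lookup_add)
  moreover have "l \<in> forms (int (mdeg u))" using lr(2) by (auto simp: forms_def supported_def)
  ultimately show ?thesis using that lr by blast
qed

text \<open>Inserting \<open>0\<close> gives the zero polynomial degree \<open>0\<close>, which is
  why the criterion for units has to ask for a nonzero element as well.\<close>

definition tdeg :: "('n::finite, 'k::field) mpoly \<Rightarrow> nat" where
  "tdeg p = Max (insert 0 (mdeg ` keys p))"

lemma tdeg_ge: "u \<in> keys p \<Longrightarrow> mdeg u \<le> tdeg p"
  by (simp add: tdeg_def)

lemma tdeg_form_part:
  fixes p :: "('n::finite, 'k::field) mpoly"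
  assumes "p \<noteq> 0"
  obtains l r where "l \<noteq> 0" "l \<in> forms (int (tdeg p))" "p = l + r" "r \<in> supported {v. mdeg v < tdeg p}"
proof -
  have "keys p \<noteq> {}" using assms by (meson keys_eq_empty)
  then have "tdeg p \<in> mdeg ` keys p"
    unfolding tdeg_def by (subst Max_insert) (auto simp: max_def intro!: Max_in)
  then obtain u where u: "u \<in> keys p" "mdeg u = tdeg p" by auto
  have "p \<in> supported {v. mdeg v \<le> tdeg p}" using tdeg_ge by (auto simp: supported_def)
  then obtain l r where "l \<noteq> 0" "l \<in> forms (int (mdeg u))" "p = l + r"
      "r \<in> supported ({v. mdeg v \<le> tdeg p} - {v. mdeg v = mdeg u})"
    using form_part u(1) by metis
  then show ?thesis using u
    by (intro that[of l r]) (auto intro: subsetD[OF supported_mono, rotated])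
qed

lemma low_form_part:
  fixes p :: "('n::finite, 'k::field) mpoly"
  assumes "p \<noteq> 0"
  obtains s l r where "l \<noteq> 0" "l \<in> forms (int s)" "p = l + r" "r \<in> supported {v. mdeg v > s}"
    "s \<le> tdeg p"
proof -
  have ne: "keys p \<noteq> {}" using assms by (meson keys_eq_empty)
  define s where "s = Min (mdeg ` keys p)"
  have "s \<in> mdeg ` keys p" using ne by (auto simp: s_def intro!: Min_in)
  then obtain u where u: "u \<in> keys p" "mdeg u = s" by auto
  have "p \<in> supported {v. mdeg v \<ge> s}" by (auto simp: supported_def s_def)
  then obtain l r where "l \<noteq> 0" "l \<in> forms (int (mdeg u))" "p = l + r"
      "r \<in> supported ({v. mdeg v \<ge> s} - {v. mdeg v = mdeg u})"
    using form_part u(1) by metis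
  moreover have "s \<le> tdeg p" using u tdeg_ge by blast
  ultimately show ?thesis using u
    by (intro that[of l s r]) (auto intro: subsetD[OF supported_mono, rotated])
qed

text \<open>The sets of exponents are left open so that the same expansion serves the parts of
  highest degree, for \<open>tdeg_mult\<close>, and those of lowest degree, for
  \<open>forms_factor\<close>.\<close>

lemma mult_low_parts:
  fixes l m r s :: "('n::finite, 'k::field) mpoly"
  assumes "l \<in> supported U" "m \<in> supported W" "r \<in> supported U'" "s \<in> supported W'"
    "\<And>u w. u \<in> U \<Longrightarrow> w \<in> W' \<Longrightarrow> u + w \<in> Z" "\<And>u w. u \<in> U' \<Longrightarrow> w \<in> W \<Longrightarrow> u + w \<in> Z"
    "\<And>u w. u \<in> U' \<Longrightarrow> w \<in> W' \<Longrightarrow> u + w \<in> Z"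
  shows "(l + r) * (m + s) - l * m \<in> supported Z"
proof -
  have "(l + r) * (m + s) - l * m = l * s + r * m + r * s" by (simp add: algebra_simps)
  moreover have "l * s \<in> supported Z" "r * m \<in> supported Z" "r * s \<in> supported Z"
    using supported_mult[OF assms(1,4,5)] supported_mult[OF assms(3,2,6)] supported_mult[OF assms(3,4,7)]
    by auto
  ultimately show ?thesis by (simp add: supported_add)
qed

lemma forms_tdeg:
  assumes "p \<in> forms (int d)" "p \<noteq> 0" shows "tdeg p = d"
proof -
  obtain l r where "l \<noteq> 0" "l \<in> forms (int (tdeg p))" "p = l + r" "r \<in> supported {v. mdeg v < tdeg p}"
    using tdeg_form_part[OF assms(2)] .
  then have "int d = int (tdeg p)"
    by (intro forms_part_degree[OF assms(1)])
      (auto intro: subsetD[OF supported_mono, rotated])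
  then show ?thesis by simp
qed

lemma tdeg_mult:
  fixes a b :: "('n::finite, 'k::field) mpoly"
  assumes "a \<noteq> 0" "b \<noteq> 0" shows "tdeg (a * b) = tdeg a + tdeg b"
proof -
  obtain l r where a: "l \<noteq> 0" "l \<in> forms (int (tdeg a))" "a = l + r" "r \<in> supported {v. mdeg v < tdeg a}"
    using tdeg_form_part[OF assms(1)] .
  obtain m s where b: "m \<noteq> 0" "m \<in> forms (int (tdeg b))" "b = m + s" "s \<in> supported {v. mdeg v < tdeg b}"
    using tdeg_form_part[OF assms(2)] .
  have "(l + r) * (m + s) - l * m \<in> supported {v. mdeg v < tdeg a + tdeg b}"
    using a(2) b(2) a(4) b(4) unfolding forms_supported
    by (rule mult_low_parts) (auto simp: mdeg_add)
  then have low: "a * b - l * m \<in> supported {v. mdeg v < tdeg a + tdeg b}"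
    by (simp flip: a(3) b(3))
  have lm: "l * m \<in> forms (int (tdeg a + tdeg b))" "l * m \<noteq> 0"
    using forms_mult[OF a(2) b(2)] a(1) b(1) by auto
  obtain u where u: "u \<in> keys (l * m)" using lm(2) by (meson all_not_in_conv keys_eq_empty)
  then have du: "mdeg u = tdeg a + tdeg b" using lm(1) by (auto simp: forms_def)
  then have "u \<notin> keys (a * b - l * m)" using low by (auto simp: supported_def)
  then have "u \<in> keys (a * b)" using u by (auto simp: in_keys_iff lookup_minus)
  then have 1: "tdeg a + tdeg b \<le> tdeg (a * b)" using tdeg_ge du by metis
  have "mdeg w \<le> tdeg a + tdeg b" if "w \<in> keys (a * b)" for w
  proof -
    obtain x y where "x \<in> keys a" "y \<in> keys b" "w = x + y" using keys_mult[of a b] \<open>w \<in> keys (a * b)\<close> by blast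
    then show ?thesis using tdeg_ge[of x a] tdeg_ge[of y b] by (simp add: mdeg_add)
  qed
  then have "tdeg (a * b) \<le> tdeg a + tdeg b" by (simp add: tdeg_def)
  with 1 show ?thesis by simp
qed

text \<open>Highest and lowest degrees are both additive. They agree for the homogeneous product,
  hence they agree for each factor.\<close>

lemma forms_factor:
  fixes a b :: "('n::finite, 'k::field) mpoly"
  assumes ab: "a * b \<in> forms m" "a * b \<noteq> 0"
  shows "a \<in> forms (int (tdeg a))"
proof -
  have ne: "a \<noteq> 0" "b \<noteq> 0" using ab by auto
  obtain l r where a: "l \<noteq> 0" "l \<in> forms (int (tdeg a))" "a = l + r" "r \<in> supported {v. mdeg v < tdeg a}"
    using tdeg_form_part[OF ne(1)] .
  obtain n l' r' where a': "l' \<noteq> 0" "l' \<in> forms (int n)" "a = l' + r'" "r' \<in> supported {v. mdeg v > n}"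
      "n \<le> tdeg a"
    using low_form_part[OF ne(1)] .
  obtain k m' s' where b': "m' \<noteq> 0" "m' \<in> forms (int k)" "b = m' + s'" "s' \<in> supported {v. mdeg v > k}"
      "k \<le> tdeg b"
    using low_form_part[OF ne(2)] .
  have m0: "m \<ge> 0" using ab forms_neg[of "a * b" m] by fastforce
  then have "tdeg (a * b) = nat m" using ab by (intro forms_tdeg) auto
  then have m1: "m = int (tdeg a + tdeg b)" using tdeg_mult[OF ne] m0 by simp
  have "(l' + r') * (m' + s') - l' * m' \<in> supported {v. mdeg v \<noteq> n + k}"
    using a'(2) b'(2) a'(4) b'(4) unfolding forms_supported
    by (rule mult_low_parts) (auto simp: mdeg_add)
  then have "a * b - l' * m' \<in> supported {v. mdeg v \<noteq> n + k}"
    by (simp flip: a'(3) b'(3))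
  moreover have "l' * m' \<in> forms (int (n + k))" using forms_mult[OF a'(2) b'(2)] by simp
  ultimately have "m = int (n + k)"
    using a'(1) b'(1) by (intro forms_part_degree[OF ab(1)]) auto
  with m1 a'(5) b'(5) have "n = tdeg a" by linarith
  moreover have "mdeg v \<ge> n" if "v \<in> keys a" for v
    using that a'(2,4) keys_add[of l' r'] unfolding a'(3) by (force simp: forms_def supported_def)
  ultimately show ?thesis using tdeg_ge[of _ a] by (force simp: forms_def)
qed

lemma forms_dvd:
  fixes a b :: "('n::finite, 'k::field) mpoly"
  assumes "a dvd b" "b \<in> forms m" "b \<noteq> 0" shows "a \<in> forms (int (tdeg a))"
  using assms forms_factor by (metis dvdE)

lemma tdeg_0_const:
  assumes "tdeg p = 0" obtains c where "p = const c"
proof -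
  have "p \<in> forms 0" using tdeg_ge[of _ p] assms by (auto simp: forms_def)
  then show ?thesis using forms_0_const that by blast
qed

lemma tdeg_const [simp]: "tdeg (const c) = 0"
  by (simp add: tdeg_def const_def)

lemma mpoly_unit_iff:
  fixes a :: "('n::finite, 'k::field) mpoly"
  shows "a dvd 1 \<longleftrightarrow> a \<noteq> 0 \<and> tdeg a = 0"
proof
  assume "a dvd 1"
  then obtain b where b: "1 = a * b" by (auto simp: dvd_def)
  then have "a \<noteq> 0" "b \<noteq> 0" by auto
  moreover have "tdeg (1 :: ('n, 'k) mpoly) = 0" using tdeg_const[of 1] by (simp add: const_1)
  ultimately show "a \<noteq> 0 \<and> tdeg a = 0" using tdeg_mult[of a b] b by simp
next
  assume "a \<noteq> 0 \<and> tdeg a = 0"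
  then show "a dvd 1" by (metis tdeg_0_const const_dvd const_eq_0_iff)
qed

section \<open>Existence of factorizations\<close>

lemma irreducible_factor_exists:
  fixes a :: "('n::finite, 'k::field) mpoly"
  assumes "a \<noteq> 0" "\<not> a dvd 1"
  shows "\<exists>p. irreducible p \<and> p dvd a"
  using assms
proof (induction "tdeg a" arbitrary: a rule: less_induct)
  case less
  show ?case
  proof (cases "irreducible a")
    case False
    then obtain b c where bc: "a = b * c" "\<not> b dvd 1" "\<not> c dvd 1"
      using less.prems by (auto simp: irreducible_def)
    then have "b \<noteq> 0" "c \<noteq> 0" using less.prems by auto
    then have "tdeg b < tdeg a" using bc tdeg_mult[of b c] by (simp add: mpoly_unit_iff)
    then obtain p where "irreducible p" "p dvd b" using less.hyps bc(2) \<open>b \<noteq> 0\<close> by blast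
    then show ?thesis using bc(1) by auto
  qed auto
qed

text \<open>Existence of factorizations as an induction rule: removing an irreducible factor lowers
  the total degree, and a unit remains at the end.\<close>

lemma mpoly_factor_induct [consumes 1, case_names unit mult]:
  fixes a :: "('n::finite, 'k::field) mpoly"
  assumes "a \<noteq> 0" "\<And>a. a dvd 1 \<Longrightarrow> P a"
    "\<And>p a. irreducible p \<Longrightarrow> a \<noteq> 0 \<Longrightarrow> P a \<Longrightarrow> P (p * a)"
  shows "P a"
  using assms(1)
proof (induction "tdeg a" arbitrary: a rule: less_induct)
  case less
  show ?case
  proof (cases "a dvd 1")
    case False
    then obtain p b where p: "irreducible p" "a = p * b"
      using irreducible_factor_exists less.prems by (metis dvdE)
    then have "p \<noteq> 0" "b \<noteq> 0" "\<not> p dvd 1" using less.prems by (auto simp: irreducible_def)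
    then have "tdeg b < tdeg a" using p tdeg_mult[of p b] by (simp add: mpoly_unit_iff)
    then show ?thesis using less.hyps p \<open>b \<noteq> 0\<close> assms(3) by blast
  qed (use assms(2) in auto)
qed

section \<open>Unique factorization\<close>

text \<open>Primality is relative to \<open>polys_in A\<close> so that variables can be added one by
  one, while divisibility is taken in the full ring; by \<open>polys_in_factor\<close> a nonzero
  quotient stays in \<open>polys_in A\<close>.\<close>

definition prime_in :: "'n set \<Rightarrow> ('n, 'k::field) mpoly \<Rightarrow> bool" where
  "prime_in A p \<longleftrightarrow> (\<forall>a\<in>polys_in A. \<forall>b\<in>polys_in A. p dvd a * b \<longrightarrow> p dvd a \<or> p dvd b)"

text \<open>For \<open>p\<close> free of \<open>x\<^sub>i\<close>, the leading coefficient of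
  \<open>p * w\<close> is \<open>p\<close> times that of \<open>w\<close>. The two expansions must
  have the same degree, since otherwise the higher leading term would have nothing to cancel
  against.\<close>

lemma dvd_leading_coeff:
  fixes p c r :: "('n::finite, 'k::field) mpoly"
  assumes p: "p \<in> polys_in (- {i})" and c: "c \<in> polys_in (- {i})" and r: "r \<in> xdeg_less i k"
    and dvd: "p dvd c * var i ^ k + r"
  shows "p dvd c"
proof (cases "c = 0")
  case False
  obtain w where w: "c * var i ^ k + r = p * w" using dvd by (auto simp: dvd_def)
  have "c * var i ^ k + r \<noteq> 0"
  proof
    assume "c * var i ^ k + r = 0"
    then have "c * var i ^ k = - r" by (simp add: eq_neg_iff_add_eq_0)
    then have "c = 0" using xdeg_lead_eq_0 xdeg_less_uminus[OF r] by metis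
    with False show False by simp
  qed
  then have w0: "w \<noteq> 0" "p \<noteq> 0" using w by auto
  have [simp]: "insert i (- {i}) = UNIV" by auto
  obtain D m w' where D: "m \<in> polys_in (- {i})" "m \<noteq> 0" "w = m * var i ^ D + w'" "w' \<in> xdeg_less i D"
    by (rule xdeg_lead_cases[of w i "- {i}"]) (use w0 in auto)
  have eq: "c * var i ^ k + r = (p * m) * var i ^ D + p * w'" unfolding w D(3) by (simp add: algebra_simps)
  have pw: "p * w' \<in> xdeg_less i D" by (rule xdeg_less_mult_polys_in[OF p D(4)])
  have "D = k"
  proof (rule ccontr)
    assume "D \<noteq> k"
    then consider "D < k" | "k < D" by linarith
    then show False
    proof cases
      case 1
      have "(p * m) * var i ^ D \<in> xdeg_less i k"
        using 1 p D(1) by (intro xdeg_less_mult_polys_in polys_in_mult xdeg_less_mono[OF _ var_power_xdeg]) auto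
      moreover have "p * w' \<in> xdeg_less i k" using pw 1 by (intro xdeg_less_mono[OF _ pw]) auto
      ultimately have "(p * m) * var i ^ D + p * w' - r \<in> xdeg_less i k"
        using r by (intro xdeg_less_diff xdeg_less_add)
      then have "c * var i ^ k \<in> xdeg_less i k" unfolding eq[symmetric] by simp
      then have "c = 0" by (rule xdeg_lead_eq_0)
      with False show False ..
    next
      case 2
      have "c * var i ^ k \<in> xdeg_less i D"
        using 2 c by (intro xdeg_less_mult_polys_in xdeg_less_mono[OF _ var_power_xdeg]) auto
      moreover have "r \<in> xdeg_less i D" using 2 by (intro xdeg_less_mono[OF _ r]) auto
      ultimately have "c * var i ^ k + r - p * w' \<in> xdeg_less i D"
        using pw by (intro xdeg_less_diff xdeg_less_add)
      then have "(p * m) * var i ^ D \<in> xdeg_less i D" unfolding eq by simp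
      then have "p * m = 0" by (rule xdeg_lead_eq_0)
      with w0 D show False by simp
    qed
  qed
  have "(c - p * m) * var i ^ k = p * w' - r" using eq \<open>D = k\<close> by (simp add: algebra_simps)
  then have "c - p * m = 0"
    using xdeg_lead_eq_0 xdeg_less_diff[OF pw[unfolded \<open>D = k\<close>] r] by metis
  then show ?thesis by simp
qed simp

text \<open>The half of Gauss's lemma on coefficients. As \<open>p\<close> divides the product of
  the leading coefficients, it divides one of them; dropping that leading term lowers the sum of the
  two degree bounds.\<close>

lemma prime_in_insert:
  fixes p :: "('n::finite, 'k::field) mpoly"
  assumes p: "p \<in> polys_in A" "prime_in A p" and i: "i \<notin> A"
  shows "prime_in (insert i A) p"
proof -
  have A: "polys_in A \<subseteq> polys_in (- {i})" using i by (intro polys_in_mono) auto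
  have "p dvd a \<or> p dvd b"
    if "a \<in> polys_in (insert i A)" "b \<in> polys_in (insert i A)" "a \<in> xdeg_less i d" "b \<in> xdeg_less i e"
      "p dvd a * b" for a b d e
    using that
  proof (induction "d + e" arbitrary: a b d e rule: less_induct)
    case less
    show ?case
    proof (cases "d = 0 \<or> e = 0")
      case True
      then show ?thesis using less.prems by (auto simp: xdeg_less_zero_iff)
    next
      case False
      then obtain d' e' where de: "d = Suc d'" "e = Suc e'" by (metis not0_implies_Suc)
      obtain l a' where a: "l \<in> polys_in A" "a = l * var i ^ d' + a'" "a' \<in> xdeg_less i d'"
          "a' \<in> polys_in (insert i A)"
        using xdeg_leading_coeff[OF less.prems(1) less.prems(3)[unfolded de] i] .
      obtain m b' where b: "m \<in> polys_in A" "b = m * var i ^ e' + b'" "b' \<in> xdeg_less i e'"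
          "b' \<in> polys_in (insert i A)"
        using xdeg_leading_coeff[OF less.prems(2) less.prems(4)[unfolded de] i] .
      obtain r where r: "a * b = (l * m) * var i ^ (d' + e') + r" "r \<in> xdeg_less i (d' + e')"
        using mult_leading[OF a(2) b(2) a(3) b(3)] a(1) b(1) A by blast
      have "p dvd l * m"
        by (rule dvd_leading_coeff[OF _ _ r(2)]) (use less.prems(5) r(1) p a(1) b(1) A polys_in_mult in auto)
      then consider "p dvd l" | "p dvd m" using p(2) a(1) b(1) unfolding prime_in_def by blast
      then show ?thesis
      proof cases
        case 1
        have "a' * b = a * b - l * (var i ^ d' * b)" by (simp add: a(2) algebra_simps)
        then have "p dvd a' * b" using 1 less.prems(5) by (simp add: dvd_diff)
        then have "p dvd a' \<or> p dvd b"
          using less.hyps[of d' e a' b] less.prems a de by simp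
        then show ?thesis using 1 by (auto simp: a(2) intro: dvd_add)
      next
        case 2
        have "a * b' = a * b - m * (var i ^ e' * a)" by (simp add: b(2) algebra_simps)
        then have "p dvd a * b'" using 2 less.prems(5) by (simp add: dvd_diff)
        then have "p dvd a \<or> p dvd b'"
          using less.hyps[of d e' a b'] less.prems b de by simp
        then show ?thesis using 2 by (auto simp: b(2) intro: dvd_add)
      qed
    qed
  qed
  then show ?thesis unfolding prime_in_def using xdeg_less_exists by metis
qed

text \<open>Euclid's algorithm over the fraction field of the coefficient ring, with the
  denominators cleared.\<close>

lemma pseudo_gcd:
  fixes p a :: "('n::finite, 'k::field) mpoly"
  assumes i: "i \<notin> A" and p: "p \<in> polys_in (insert i A)" "p \<noteq> 0" and a: "a \<in> polys_in (insert i A)"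
  obtains u v c where "u \<in> polys_in (insert i A)" "v \<in> polys_in (insert i A)" "c = u * p + v * a" "c \<noteq> 0"
    "\<exists>s q. s \<in> polys_in A \<and> s \<noteq> 0 \<and> q \<in> polys_in (insert i A) \<and> s * p = q * c"
    "\<exists>s q. s \<in> polys_in A \<and> s \<noteq> 0 \<and> q \<in> polys_in (insert i A) \<and> s * a = q * c"
proof -
  define B where "B = (polys_in (insert i A) :: ('n, 'k) mpoly set)"
  define I where "I = {u * p + v * a | u v. u \<in> B \<and> v \<in> B}"
  have A: "polys_in A \<subseteq> polys_in (- {i})" using i by (intro polys_in_mono) auto
  have AB: "polys_in A \<subseteq> B" unfolding B_def by (intro polys_in_mono) auto
  have IB: "I \<subseteq> B" using p a by (auto simp: I_def B_def intro!: polys_in_closed)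
  have I_diff: "f * g - f' * g' \<in> I" if fg: "f \<in> B" "g \<in> I" "f' \<in> B" "g' \<in> I" for f g f' g'
  proof -
    obtain u v u' v' where uv: "g = u * p + v * a" "g' = u' * p + v' * a" "u \<in> B" "v \<in> B" "u' \<in> B" "v' \<in> B"
      using fg(2,4) unfolding I_def by blast
    then have "f * g - f' * g' = (f * u - f' * u') * p + (f * v - f' * v') * a" by (simp add: algebra_simps)
    moreover have "f * u - f' * u' \<in> B" "f * v - f' * v' \<in> B"
      using fg uv by (auto simp: B_def intro!: polys_in_closed)
    ultimately show ?thesis unfolding I_def by blast
  qed
  have "p = 1 * p + 0 * a" "a = 0 * p + 1 * a" by auto
  then have pI: "p \<in> I" and aI: "a \<in> I" unfolding I_def B_def using polys_in_0 polys_in_1 by blast+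
  \<comment> \<open>A nonzero \<open>c\<close> of least degree in the ideal \<open>(p, a)\<close>
    generates that ideal over the fraction field of \<open>polys_in A\<close>.\<close>
  define D where "D = (LEAST D. \<exists>c\<in>I. c \<noteq> 0 \<and> c \<in> xdeg_less i D)"
  have "\<exists>D. \<exists>c\<in>I. c \<noteq> 0 \<and> c \<in> xdeg_less i D" using pI p(2) xdeg_less_exists[of p i] by blast
  then have "\<exists>c\<in>I. c \<noteq> 0 \<and> c \<in> xdeg_less i D" unfolding D_def by (rule LeastI_ex)
  then obtain c where c: "c \<in> I" "c \<noteq> 0" "c \<in> xdeg_less i D" by blast
  have minD: "g = 0" if "g \<in> I" "g \<in> xdeg_less i n" "n < D" for g n
    using not_less_Least[of n "\<lambda>D. \<exists>c\<in>I. c \<noteq> 0 \<and> c \<in> xdeg_less i D"] that unfolding D_def by blast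
  have "D \<noteq> 0" using c by (metis xdeg_less_zero_iff)
  then obtain D' where D': "D = Suc D'" by (metis not0_implies_Suc)
  obtain l c' where l: "l \<in> polys_in A" "c = l * var i ^ D' + c'" "c' \<in> xdeg_less i D'"
    using xdeg_leading_coeff[of c i A D'] c IB i D' unfolding B_def by blast
  have l0: "l \<noteq> 0" using minD[of c D'] c l D' by auto
  \<comment> \<open>Pseudo-division by \<open>c\<close>: multiplying \<open>g\<close> by the leading
    coefficient \<open>l\<close> of \<open>c\<close> allows its leading term to be cancelled, and
    \<open>s\<close> collects these multipliers.\<close>
  have red: "\<exists>s q. s \<in> polys_in A \<and> s \<noteq> 0 \<and> q \<in> B \<and> s * g = q * c" if "g \<in> I" "g \<in> xdeg_less i n" for g n
    using that
  proof (induction n arbitrary: g)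
    case 0
    then have "1 * g = 0 * c" by (simp add: xdeg_less_zero_iff)
    then show ?case unfolding B_def using polys_in_1 polys_in_0 zero_neq_one by metis
  next
    case (Suc n)
    show ?case
    proof (cases "n < D'")
      case True
      then have "g = 0" using minD[OF Suc.prems] D' by simp
      then have "1 * g = 0 * c" by simp
      then show ?thesis unfolding B_def using polys_in_1 polys_in_0 zero_neq_one by metis
    next
      case False
      have "g \<in> polys_in (insert i A)" using Suc.prems IB B_def by blast
      from xdeg_leading_coeff[OF this Suc.prems(2) i]
      obtain m g' where m: "m \<in> polys_in A" "g = m * var i ^ n + g'" "g' \<in> xdeg_less i n" .
      let ?t = "m * var i ^ (n - D')"
      have X: "var i ^ n = var i ^ (n - D') * var i ^ D'" using False by (simp flip: power_add)
      have t: "?t \<in> B" using m AB unfolding B_def by (intro polys_in_closed) auto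
      have h: "l * g - ?t * c \<in> I" using I_diff Suc.prems(1) c(1) t l(1) AB by blast
      have "l * g - ?t * c = l * g' - m * (c' * var i ^ (n - D'))"
        by (simp add: m(2) l(2) X algebra_simps)
      moreover have "l * g' \<in> xdeg_less i n" using l m A by (auto intro: xdeg_less_mult_polys_in)
      moreover have "c' * var i ^ (n - D') \<in> xdeg_less i n"
        using xdeg_less_mult_var_power[OF l(3), of "n - D'"] False by simp
      then have "m * (c' * var i ^ (n - D')) \<in> xdeg_less i n" using m A by (auto intro: xdeg_less_mult_polys_in)
      ultimately have "l * g - ?t * c \<in> xdeg_less i n" by (simp add: xdeg_less_diff)
      with Suc.IH h obtain s q where sq: "s \<in> polys_in A" "s \<noteq> 0" "q \<in> B" "s * (l * g - ?t * c) = q * c"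
        by blast
      then have "(s * l) * g = (q + s * ?t) * c" by (simp add: algebra_simps)
      moreover have "s * l \<in> polys_in A" "s * l \<noteq> 0" using sq l l0 by (auto intro: polys_in_mult)
      moreover have "q + s * ?t \<in> B" using sq m AB unfolding B_def by (intro polys_in_closed) auto
      ultimately show ?thesis by blast
    qed
  qed
  obtain u v where "u \<in> B" "v \<in> B" "c = u * p + v * a" using c(1) by (auto simp: I_def)
  moreover obtain n1 n2 where "p \<in> xdeg_less i n1" "a \<in> xdeg_less i n2" using xdeg_less_exists by metis
  ultimately show ?thesis
    using that[of u v c] c(2) red[OF pI] red[OF aI] unfolding B_def by blast
qed

text \<open>An irreducible element of the coefficient ring stays irreducible over its fraction
  field. Each irreducible factor of \<open>s\<close> is prime after adding \<open>x\<^sub>i\<close>,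
  so it divides \<open>q\<close> or \<open>c\<close> and cancels there; once \<open>s\<close> is a
  unit, the irreducibility of \<open>p\<close> makes \<open>q\<close> or \<open>c\<close> a
  unit.\<close>

lemma strip_coefficient_factor:
  fixes p q c s :: "('n::finite, 'k::field) mpoly"
  assumes H: "\<And>r :: ('n, 'k) mpoly. irreducible r \<Longrightarrow> r \<in> polys_in A \<Longrightarrow> prime_in (insert i A) r"
    and p: "irreducible p"
    and s: "s \<noteq> 0" "s \<in> polys_in A"
    and qc: "q \<in> polys_in (insert i A)" "c \<in> polys_in (insert i A)" "s * p = q * c"
  shows "q \<in> polys_in A \<or> c \<in> polys_in A"
  using s qc
proof (induction s arbitrary: q c rule: mpoly_factor_induct)
  case (unit s)
  have unit_in: "x \<in> polys_in A" if x: "x dvd 1" for x :: "('n, 'k) mpoly"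
    using polys_in_dvd[OF x polys_in_1] by simp
  obtain s' where "1 = s * s'" using unit(1) by (auto simp: dvd_def)
  then have "p = s' * (s * p)" by (metis mult.assoc mult.commute mult_1)
  then have "p = (s' * q) * c" using unit(5) by (simp add: mult.assoc)
  then consider "s' * q dvd 1" | "c dvd 1" using p by (meson irreducible_def)
  then show ?case
  proof cases
    case 1
    then have "q dvd 1" using dvd_mult_right by blast
    then show ?thesis using unit_in by blast
  qed (use unit_in in blast)
next
  case (mult r s)
  have r0: "r \<noteq> 0" "r * s \<noteq> 0" using mult by auto
  have rs: "r \<in> polys_in A" "s \<in> polys_in A"
    using mult.prems(1) r0 polys_in_factor[of r s A] polys_in_factor[of s r A] by (auto simp: mult.commute)
  have eq: "r * (s * p) = q * c" using mult.prems(4) by (simp add: mult.assoc)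
  then have "r dvd q * c" by (metis dvd_triv_left)
  then consider "r dvd q" | "r dvd c" using H[OF mult.hyps(1) rs(1)] mult.prems unfolding prime_in_def by blast
  then show ?case
  proof cases
    case 1
    then obtain q' where q': "q = r * q'" by (auto simp: dvd_def)
    then have "r * (s * p) = r * (q' * c)" using eq by (simp add: mult.assoc)
    then have sp: "s * p = q' * c" using r0 mpoly_mult_left_cancel by blast
    show ?thesis
    proof (cases "q = 0")
      case False
      then have "q' \<in> polys_in (insert i A)" using polys_in_dvd[of q' q] q' mult.prems(2) by simp
      then show ?thesis using mult.IH[OF rs(2) _ mult.prems(3) sp] q' rs(1) by (auto intro: polys_in_mult)
    qed simp
  next
    case 2
    then obtain c' where c': "c = r * c'" by (auto simp: dvd_def)
    then have "r * (s * p) = r * (q * c')" using eq by (simp add: mult.assoc mult.left_commute)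
    then have sp: "s * p = q * c'" using r0 mpoly_mult_left_cancel by blast
    show ?thesis
    proof (cases "c = 0")
      case False
      then have "c' \<in> polys_in (insert i A)" using polys_in_dvd[of c' c] c' mult.prems(3) by simp
      then show ?thesis using mult.IH[OF rs(2) mult.prems(2) _ sp] c' rs(1) by (auto intro: polys_in_mult)
    qed simp
  qed
qed

text \<open>Write \<open>t * b = p * w\<close>. An irreducible factor of \<open>t\<close> is prime
  and cannot divide \<open>p\<close>, since \<open>p\<close> would then be that factor times a unit
  and would lie in \<open>polys_in A\<close>. Hence it divides \<open>w\<close> and cancels.\<close>

lemma strip_coefficient_dvd:
  fixes p t b :: "('n::finite, 'k::field) mpoly"
  assumes H: "\<And>r :: ('n, 'k) mpoly. irreducible r \<Longrightarrow> r \<in> polys_in A \<Longrightarrow> prime_in (insert i A) r"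
    and p: "irreducible p" "p \<notin> polys_in A" "p \<in> polys_in (insert i A)"
    and t: "t \<noteq> 0" "t \<in> polys_in A"
    and b: "b \<in> polys_in (insert i A)" "p dvd t * b"
  shows "p dvd b"
  using t b
proof (induction t rule: mpoly_factor_induct)
  case (unit t)
  then obtain t' where "1 = t * t'" by (auto simp: dvd_def)
  then have "b = t' * (t * b)" by (metis mult.assoc mult.commute mult_1)
  then show ?case using unit(4) by (metis dvd_mult)
next
  case (mult r t)
  have r0: "r \<noteq> 0" "r * t \<noteq> 0" "p \<noteq> 0" using mult p by (auto simp: irreducible_def)
  have rs: "r \<in> polys_in A" "t \<in> polys_in A"
    using mult.prems(1) r0 polys_in_factor[of r t A] polys_in_factor[of t r A] by (auto simp: mult.commute)
  show ?case
  proof (cases "b = 0")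
    case False
    obtain w where w: "r * t * b = p * w" using mult.prems by (auto simp: dvd_def)
    have A: "polys_in A \<subseteq> polys_in (insert i A)" by (intro polys_in_mono) auto
    have "r * t * b \<in> polys_in (insert i A)" using rs mult.prems A by (intro polys_in_mult) auto
    moreover have "r * t * b \<noteq> 0" using False r0 by simp
    ultimately have "w \<in> polys_in (insert i A)" unfolding w by (metis polys_in_factor mult.commute)
    moreover have "r dvd p * w" unfolding w[symmetric] by (simp add: mult.assoc)
    ultimately consider "r dvd p" | "r dvd w"
      using H[OF mult.hyps(1) rs(1)] p unfolding prime_in_def by blast
    then show ?thesis
    proof cases
      case 1
      then obtain z where z: "p = r * z" by (auto simp: dvd_def)
      have "\<not> r dvd 1" using mult.hyps(1) by (simp add: irreducible_def)
      with z p(1) have "z dvd 1" by (meson irreducible_def)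
      then have "z \<in> polys_in A" using polys_in_dvd[OF _ polys_in_1] by simp
      then have "p \<in> polys_in A" unfolding z using rs(1) by (intro polys_in_mult)
      with p show ?thesis by blast
    next
      case 2
      then obtain w' where "w = r * w'" by (auto simp: dvd_def)
      with w have "r * (t * b) = r * (p * w')" by (simp add: mult.assoc mult.left_commute)
      then have "t * b = p * w'" using r0 mpoly_mult_left_cancel by blast
      then show ?thesis using mult.IH rs mult.prems by simp
    qed
  qed simp
qed

text \<open>If \<open>p\<close> involves \<open>x\<^sub>i\<close>, let \<open>c\<close> be a gcd of
  \<open>p\<close> and \<open>a\<close> over the fraction field of the coefficients. Irreducibility
  leaves two cases: \<open>c\<close> is \<open>p\<close> up to coefficients and \<open>p\<close>
  divides \<open>a\<close>, or \<open>c\<close> is itself a coefficient and the relation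
  \<open>c = u * p + v * a\<close>, multiplied by \<open>b\<close>, gives that \<open>p\<close>
  divides \<open>b\<close>.\<close>

lemma gauss_step:
  fixes p :: "('n::finite, 'k::field) mpoly"
  assumes H: "\<And>r :: ('n, 'k) mpoly. irreducible r \<Longrightarrow> r \<in> polys_in A \<Longrightarrow> prime_in A r" and i: "i \<notin> A"
    and p: "irreducible p" "p \<in> polys_in (insert i A)"
  shows "prime_in (insert i A) p"
proof (cases "p \<in> polys_in A")
  case True
  then show ?thesis using prime_in_insert H p i by blast
next
  case False
  have H': "prime_in (insert i A) r" if "irreducible r" "r \<in> polys_in A" for r :: "('n, 'k) mpoly"
    using prime_in_insert H that i by blast
  have p0: "p \<noteq> 0" using p by (auto simp: irreducible_def)
  have A: "polys_in A \<subseteq> polys_in (insert i A)" by (intro polys_in_mono) auto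
  have "p dvd a \<or> p dvd b"
    if ab: "a \<in> polys_in (insert i A)" "b \<in> polys_in (insert i A)" "p dvd a * b" for a b
  proof -
    obtain u v c s q s' q' where
      uv: "u \<in> polys_in (insert i A)" "v \<in> polys_in (insert i A)" "c = u * p + v * a" "c \<noteq> 0"
      and s: "s \<in> polys_in A" "s \<noteq> 0" "q \<in> polys_in (insert i A)" "s * p = q * c"
      and s': "s' \<in> polys_in A" "s' \<noteq> 0" "q' \<in> polys_in (insert i A)" "s' * a = q' * c"
      using pseudo_gcd[OF i p(2) p0 ab(1)] by metis
    have "c \<in> polys_in (insert i A)" using uv p(2) ab by (auto intro!: polys_in_closed)
    then consider "q \<in> polys_in A" | "c \<in> polys_in A"
      using strip_coefficient_factor[OF H' p(1) s(2,1,3) _ s(4)] by blast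
    then show ?thesis
    proof cases
      case 1
      have "q \<noteq> 0" using s p0 by auto
      have "(q * s') * a = q' * (q * c)" using s'(4) by (metis mult.assoc mult.commute)
      also have "\<dots> = p * (q' * s)" unfolding s(4)[symmetric] by (simp add: ac_simps)
      finally have "p dvd (q * s') * a" by simp
      then have "p dvd a"
        using \<open>q \<noteq> 0\<close> s' 1 ab False p
        by (intro strip_coefficient_dvd[OF H', of p "q * s'" a]) (auto intro: polys_in_mult)
      then show ?thesis ..
    next
      case 2
      have "c * b = p * (u * b) + v * (a * b)" by (simp add: uv(3) algebra_simps)
      then have "p dvd c * b" using ab(3) by simp
      then have "p dvd b" using 2 uv(4) ab False p by (intro strip_coefficient_dvd[OF H', of p c b]) auto
      then show ?thesis ..
    qed
  qed
  then show ?thesis by (auto simp: prime_in_def)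
qed

lemma irreducible_prime_in:
  fixes p :: "('n::finite, 'k::field) mpoly"
  assumes "finite A" "irreducible p" "p \<in> polys_in A"
  shows "prime_in A p"
  using assms
proof (induction A arbitrary: p)
  case empty
  then obtain c where "p = const c" by (metis polys_in_empty)
  with empty have False by (auto simp: irreducible_def mpoly_unit_iff)
  then show ?case ..
next
  case (insert i A)
  then show ?case using gauss_step[of A i p] by blast
qed

theorem irreducible_imp_prime_elem_mpoly:
  fixes p :: "('n::finite, 'k::field) mpoly"
  assumes "irreducible p" shows "prime_elem p"
  using irreducible_prime_in[of UNIV p] assms
  by (auto simp: prime_in_def irreducible_def intro!: prime_elemI)

lemma irreducible_dvd_mult:
  fixes p :: "('n::finite, 'k::field) mpoly"
  assumes "irreducible p" shows "p dvd a * b \<longleftrightarrow> p dvd a \<or> p dvd b"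
  using irreducible_imp_prime_elem_mpoly[OF assms] by (auto dest: prime_elem_dvd_multD)

text \<open>This replaces a resultant. From \<open>s * p = q * c\<close>, the prime \<open>p\<close>
  divides \<open>c\<close> or \<open>q\<close>. If it divides \<open>c\<close>, it divides
  \<open>s' * g\<close> and so \<open>s'\<close>, hence \<open>p\<close> itself is free of
  \<open>x\<^sub>i\<close>; if it divides \<open>q\<close>, cancelling \<open>p\<close> shows that
  \<open>c\<close> divides \<open>s\<close>.\<close>

lemma elimination:
  fixes p g :: "('n::finite, 'k::field) mpoly"
  assumes p: "irreducible p" and g: "\<not> p dvd g"
  obtains u v c where "c = u * p + v * g" "c \<noteq> 0" "c \<in> polys_in (- {i})"
proof -
  have [simp]: "insert i (- {i}) = UNIV" by auto
  have p0: "p \<noteq> 0" using p by (auto simp: irreducible_def)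
  obtain u v c where uv: "c = u * p + v * g" "c \<noteq> 0"
      "\<exists>s q. s \<in> polys_in (- {i}) \<and> s \<noteq> 0 \<and> q \<in> polys_in (insert i (- {i})) \<and> s * p = q * c"
      "\<exists>s q. s \<in> polys_in (- {i}) \<and> s \<noteq> 0 \<and> q \<in> polys_in (insert i (- {i})) \<and> s * g = q * c"
    by (rule pseudo_gcd[of i "- {i}" p g]) (use p0 in auto)
  obtain s q where s: "s \<in> polys_in (- {i})" "s \<noteq> 0" "s * p = q * c" using uv(3) by blast
  obtain s' q' where s': "s' \<in> polys_in (- {i})" "s' \<noteq> 0" "s' * g = q' * c" using uv(4) by blast
  have "p dvd q * c" unfolding s(3)[symmetric] by simp
  then consider "p dvd c" | "p dvd q" using irreducible_dvd_mult[OF p] by blast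
  then show ?thesis
  proof cases
    case 1
    then have "p dvd s' * g" using s'(3) by simp
    then have "p dvd s'" using g irreducible_dvd_mult[OF p] by blast
    then have "p \<in> polys_in (- {i})" using s' polys_in_dvd by blast
    then show ?thesis using that[of p 1 0] p0 by simp
  next
    case 2
    then obtain z where "q = p * z" by (auto simp: dvd_def)
    then have "p * s = p * (z * c)" using s(3) by (simp add: ac_simps)
    then have "s = z * c" using p0 mpoly_mult_left_cancel by blast
    then have "c \<in> polys_in (- {i})" using s polys_in_dvd[of c s] by simp
    then show ?thesis using that uv by blast
  qed
qed

section \<open>Reduction modulo a linear form\<close>

text \<open>The second assumption says that \<open>x\<^sub>i\<close> occurs in \<open>l\<close>, so
  it can be solved for modulo \<open>l\<close>, and \<open>polys_in (- {i})\<close> becomes a copy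
  of the quotient ring by \<open>l\<close>.\<close>

locale linear_form =
  fixes l :: "('n::finite, 'k::field) mpoly" and i :: 'n
  assumes l_form: "l \<in> forms 1" and l_notin: "l \<notin> polys_in (- {i})"
begin

lemma l_nonzero: "l \<noteq> 0"
  using l_notin by auto

lemma l_decomp:
  obtains c r where "c \<noteq> 0" "r \<in> forms 1" "r \<in> polys_in (- {i})" "l = const c * var i + r"
proof -
  obtain a b where ab: "l = a + b" "a \<in> supported ({u. int (mdeg u) = 1} \<inter> {Poly_Mapping.single i 1})"
      "b \<in> supported ({u. int (mdeg u) = 1} - {Poly_Mapping.single i 1})"
    using supported_split l_form unfolding forms_supported by metis
  have "\<exists>w\<in>{0}. u = w + Poly_Mapping.single i 1"
    if "u \<in> {u. int (mdeg u) = 1} \<inter> {Poly_Mapping.single i 1}" for u using that by auto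
  with ab(2) obtain a' where a': "a' \<in> supported {0}" "a = a' * Poly_Mapping.single (Poly_Mapping.single i 1) 1"
    by (rule supported_div_monomial)
  have "a' \<in> forms 0" using a'(1) by (auto simp: forms_def supported_def)
  then obtain c where c: "a' = const c" by (rule forms_0_const)
  have "i \<notin> keys u" if u: "mdeg u = 1" "u \<noteq> Poly_Mapping.single i 1" for u
  proof
    assume "i \<in> keys u"
    then have "u = (u - Poly_Mapping.single i 1) + Poly_Mapping.single i 1"
      by (intro poly_mapping_eqI) (auto simp: lookup_add lookup_minus lookup_single when_def in_keys_iff)
    moreover from this have "mdeg (u - Poly_Mapping.single i 1) = 0"
      using mdeg_add[of "u - Poly_Mapping.single i 1" "Poly_Mapping.single i 1"] u(1) by simp
    ultimately show False using u(2) by simp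
  qed
  then have b: "b \<in> forms 1" "b \<in> polys_in (- {i})"
    using ab(3) by (auto simp: forms_def polys_in_def supported_def)
  have "c \<noteq> 0" using l_notin b ab(1) a'(2) c by auto
  then show ?thesis using b ab(1) a'(2) c that by (simp add: var_def)
qed

lemma division_monomial:
  "\<exists>q b. q \<in> forms (int (mdeg u) - 1) \<and> b \<in> forms (int (mdeg u)) \<and> b \<in> polys_in (- {i})
     \<and> Poly_Mapping.single u c = q * l + b"
proof -
  obtain e r where e: "e \<noteq> 0" "r \<in> forms 1" "r \<in> polys_in (- {i})" "l = const e * var i + r"
    by (rule l_decomp)
  let ?d = "const (inverse e)"
  have "?d * l = (const e * ?d) * var i + ?d * r" unfolding e(4) by (simp add: algebra_simps)
  \<comment> \<open>This is the substitution that eliminates \<open>x\<^sub>i\<close> modulo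
    \<open>l\<close>. It is homogeneous of degree one, so quotient and remainder keep the degrees
    expected of them.\<close>
  then have X: "var i = ?d * l - ?d * r" unfolding const_inverse[OF e(1)] by simp
  have power: "\<exists>q b. q \<in> forms (m + int k - 1) \<and> b \<in> forms (m + int k) \<and> b \<in> polys_in (- {i})
     \<and> var i ^ k * a = q * l + b" if a: "a \<in> forms m" "a \<in> polys_in (- {i})" for a m k
  proof (induction k)
    case 0
    show ?case using a by (intro exI[of _ 0] exI[of _ a]) auto
  next
    case (Suc k)
    then obtain q b where q: "q \<in> forms (m + int k - 1)" "b \<in> forms (m + int k)" "b \<in> polys_in (- {i})"
     "var i ^ k * a = q * l + b" by blast
    have "var i ^ Suc k * a = var i * (q * l) + var i * b"
      by (simp only: power_Suc mult.assoc q(4) distrib_left)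
    also have "var i * b = (?d * l - ?d * r) * b" by (subst X) (rule refl)
    finally have "var i ^ Suc k * a = (var i * q + ?d * b) * l + (- (?d * (r * b)))"
      by (simp add: algebra_simps)
    moreover have "var i * q + ?d * b \<in> forms (m + int (Suc k) - 1)"
      using forms_mult[OF forms_var q(1)] forms_mult[OF forms_const q(2)]
      by (intro forms_add) (simp_all add: algebra_simps)
    moreover have "- (?d * (r * b)) \<in> forms (m + int (Suc k))"
      using forms_mult[OF forms_const forms_mult[OF e(2) q(2)]]
      by (intro forms_uminus) (simp add: algebra_simps)
    moreover have "- (?d * (r * b)) \<in> polys_in (- {i})"
      using q e by (intro polys_in_closed) auto
    ultimately show ?case by blast
  qed
  let ?k = "lookup u i" and ?v = "u - Poly_Mapping.single i (lookup u i)"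
  have v: "u = Poly_Mapping.single i ?k + ?v"
    by (intro poly_mapping_eqI) (auto simp: lookup_add lookup_minus lookup_single when_def)
  have "i \<notin> keys ?v" by (simp add: in_keys_iff lookup_minus)
  then have "Poly_Mapping.single ?v c \<in> polys_in (- {i})" by (auto simp: polys_in_def supported_def)
  moreover have "Poly_Mapping.single ?v c \<in> forms (int (mdeg ?v))" by (simp add: forms_def)
  moreover have "var i ^ ?k * Poly_Mapping.single ?v c = Poly_Mapping.single u c"
    using v by (simp add: var_power mult_single)
  moreover have "mdeg u = ?k + mdeg ?v" using arg_cong[OF v, of mdeg] unfolding mdeg_add by simp
  ultimately show ?thesis using power[of "Poly_Mapping.single ?v c" "int (mdeg ?v)" ?k]
    by (simp add: add.commute)
qed

text \<open>The degrees of \<open>q\<close> and \<open>b\<close> are recorded because the Hilbert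
  function of \<open>(l, p)\<close> is computed from this division. Dividing monomial by monomial
  gives a single pair \<open>q\<close>, \<open>b\<close> that respects any degree in which
  \<open>a\<close> happens to be homogeneous.\<close>

lemma division:
  obtains q b where "b \<in> polys_in (- {i})" "a = q * l + b"
    "\<forall>m. a \<in> forms m \<longrightarrow> q \<in> forms (m - 1) \<and> b \<in> forms m"
proof -
  obtain q b where qb: "\<And>u. q u \<in> forms (int (mdeg u) - 1)" "\<And>u. b u \<in> forms (int (mdeg u))"
    "\<And>u. b u \<in> polys_in (- {i})" "\<And>u. Poly_Mapping.single u (lookup a u) = q u * l + b u"
  proof -
    have "\<forall>u. \<exists>q b. q \<in> forms (int (mdeg u) - 1) \<and> b \<in> forms (int (mdeg u)) \<and> b \<in> polys_in (- {i})
       \<and> Poly_Mapping.single u (lookup a u) = q * l + b"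
      using division_monomial by blast
    then show ?thesis using that by metis
  qed
  have "a = (\<Sum>u\<in>keys a. Poly_Mapping.single u (lookup a u))"
    by (rule sum_single_lookup) auto
  also have "\<dots> = sum q (keys a) * l + sum b (keys a)"
    unfolding qb(4) by (simp add: sum.distrib sum_distrib_right)
  finally have "a = sum q (keys a) * l + sum b (keys a)" .
  moreover have "sum b (keys a) \<in> polys_in (- {i})"
    using qb(3) unfolding polys_in_def by (intro supported_sum)
  moreover have "sum q (keys a) \<in> forms (m - 1) \<and> sum b (keys a) \<in> forms m" if "a \<in> forms m" for m
    using that qb(1,2) by (intro conjI forms_sum) (auto simp: forms_def)
  ultimately show ?thesis using that by blast
qed

text \<open>A divisor of a nonzero polynomial free of \<open>x\<^sub>i\<close> is free of
  \<open>x\<^sub>i\<close>, which \<open>l\<close> is not. This yields the uniqueness of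
  remainders.\<close>

lemma l_dvd_in: 
  assumes "l dvd a" "a \<in> polys_in (- {i})" shows "a = 0"
  using assms polys_in_dvd l_notin by blast

text \<open>This is the retraction of the ring onto \<open>polys_in (- {i})\<close> with kernel
  \<open>(l)\<close>; it turns out to be a ring homomorphism, so computations modulo
  \<open>l\<close> become equations.\<close>

definition red :: "('n, 'k) mpoly \<Rightarrow> ('n, 'k) mpoly" where
  "red a = (THE b. b \<in> polys_in (- {i}) \<and> l dvd a - b)"

lemma red_eqI:
  assumes "b \<in> polys_in (- {i})" "l dvd a - b" shows "red a = b"
  unfolding red_def
proof (rule the_equality)
  fix b' assume b': "b' \<in> polys_in (- {i}) \<and> l dvd a - b'"
  have "l dvd (a - b) - (a - b')" by (rule dvd_diff) (use assms b' in auto)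
  then have "l dvd b' - b" by simp
  then have "b' - b = 0" using assms b' by (intro l_dvd_in polys_in_diff) auto
  then show "b' = b" by simp
qed (use assms in auto)

lemma red_in: "red a \<in> polys_in (- {i})" and l_dvd_diff_red: "l dvd a - red a"
proof -
  obtain q b where b: "b \<in> polys_in (- {i})" "a = q * l + b" by (rule division[of a])
  then have "red a = b" by (intro red_eqI) auto
  with b show "red a \<in> polys_in (- {i})" "l dvd a - red a" by auto
qed

lemma red_forms: assumes "a \<in> forms m" shows "red a \<in> forms m"
proof -
  obtain q b where b: "b \<in> polys_in (- {i})" "a = q * l + b" "\<forall>m. a \<in> forms m \<longrightarrow> q \<in> forms (m - 1) \<and> b \<in> forms m"
    by (rule division[of a])
  then have "red a = b" by (intro red_eqI) auto
  with b assms show ?thesis by auto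
qed

lemma red_id [simp]: "b \<in> polys_in (- {i}) \<Longrightarrow> red b = b"
  by (rule red_eqI) auto

lemma red_add: "red (a + b) = red a + red b"
proof (rule red_eqI)
  have "l dvd (a - red a) + (b - red b)" using l_dvd_diff_red by (intro dvd_add)
  then show "l dvd a + b - (red a + red b)" by (simp add: algebra_simps)
qed (intro polys_in_add red_in)

lemma red_mult: "red (a * b) = red a * red b"
proof (rule red_eqI)
  have "l dvd (a - red a) * b + red a * (b - red b)" using l_dvd_diff_red by (intro dvd_add) auto
  then show "l dvd a * b - red a * red b" by (simp add: algebra_simps)
qed (intro polys_in_mult red_in)

lemma red_diff: "red (a - b) = red a - red b"
  using red_add[of "a - b" b] by simp

lemma red_eq_0_iff: "red a = 0 \<longleftrightarrow> l dvd a"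
proof
  show "red a = 0 \<Longrightarrow> l dvd a" using l_dvd_diff_red[of a] by simp
  show "l dvd a \<Longrightarrow> red a = 0" by (rule red_eqI) auto
qed

lemma red_1 [simp]: "red 1 = 1" and red_0 [simp]: "red 0 = 0"
  by (rule red_id, simp)+

lemma red_l [simp]: "red l = 0"
  by (simp add: red_eq_0_iff)

lemma red_power: "red (a ^ k) = red a ^ k"
  by (induction k) (auto simp: red_mult)

text \<open>For \<open>p\<close> free of \<open>x\<^sub>i\<close> this is the ideal \<open>(l, p)\<close>.\<close>

definition prime_over :: "('n, 'k) mpoly \<Rightarrow> ('n, 'k) mpoly set" where
  "prime_over p = {r. p dvd red r}"

text \<open>As \<open>red\<close> is a ring homomorphism, the primality of \<open>p\<close> in the
  full ring carries over to its preimage.\<close>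

lemma prime_over_prime_ideal:
  assumes "irreducible p" shows "prime_ideal (prime_over p)"
  unfolding prime_ideal_def
proof (intro conjI allI impI)
  show "ideal.subspace (prime_over p)"
    by (rule ideal.subspaceI) (auto simp: prime_over_def red_add red_mult)
  have "1 \<notin> prime_over p" using assms by (simp add: prime_over_def irreducible_def)
  then show "prime_over p \<noteq> UNIV" by auto
  fix a b assume "a * b \<in> prime_over p"
  then show "a \<in> prime_over p \<or> b \<in> prime_over p"
    by (simp add: prime_over_def red_mult irreducible_dvd_mult[OF assms])
qed

lemma prime_ideal_l: "prime_ideal {r. l dvd r}"
  unfolding prime_ideal_def
proof (intro conjI allI impI)
  show "ideal.subspace {r. l dvd r}"
    by (rule ideal.subspaceI) auto
  have "\<not> l dvd 1" by (simp flip: red_eq_0_iff)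
  then show "{r. l dvd r} \<noteq> UNIV" by auto
  fix a b assume "a * b \<in> {r. l dvd r}"
  then show "a \<in> {r. l dvd r} \<or> b \<in> {r. l dvd r}"
    by (simp add: red_mult flip: red_eq_0_iff)
qed

end

section \<open>Prime ideals and lower bounds for heights\<close>

lemma prime_ideal_0: "prime_ideal {0 :: ('n::finite, 'k::field) mpoly}"
  by (auto simp: prime_ideal_def ideal.subspace_def) (metis UNIV_I singletonD zero_neq_one)

lemma height_ge:
  assumes "\<And>j. j \<le> k \<Longrightarrow> prime_ideal (C j)" "\<And>j. j < k \<Longrightarrow> C j \<subset> C (Suc j)" "C k = P"
  shows "enat k \<le> height P"
  unfolding height_def using assms by (intro Sup_upper) blast

lemma prime_ideal_mult_iff:
  assumes "prime_ideal P" shows "a * b \<in> P \<longleftrightarrow> a \<in> P \<or> b \<in> P"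
  using assms ideal.subspace_scale[of P b a] ideal.subspace_scale[of P a b]
  by (auto simp: prime_ideal_def mult.commute)

lemma prime_ideal_1: "prime_ideal P \<Longrightarrow> 1 \<notin> P"
  unfolding prime_ideal_def using ideal.subspace_scale[of P 1] by fastforce

lemma prime_ideal_unit: "prime_ideal P \<Longrightarrow> a dvd 1 \<Longrightarrow> a \<notin> P"
  using prime_ideal_mult_iff prime_ideal_1 by (metis dvdE)

lemma prime_ideal_irreducible:
  fixes a :: "('n::finite, 'k::field) mpoly"
  assumes P: "prime_ideal P" and a: "a \<in> P" "a \<noteq> 0"
  shows "\<exists>p. irreducible p \<and> p dvd a \<and> p \<in> P"
  using a(2,1)
proof (induction a rule: mpoly_factor_induct)
  case (unit a)
  then show ?case using prime_ideal_unit[OF P] by blast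
next
  case (mult p a)
  show ?case
  proof (cases "p \<in> P")
    case True
    then show ?thesis using mult by (intro exI[of _ p]) auto
  next
    case False
    then have "a \<in> P" using mult.prems prime_ideal_mult_iff[OF P] by blast
    then obtain q where "irreducible q" "q dvd a" "q \<in> P" using mult.IH by blast
    then show ?thesis by (intro exI[of _ q]) auto
  qed
qed

context linear_form
begin

lemma mem_ideal_red:
  assumes "ideal.subspace P" "l \<in> P" shows "r \<in> P \<longleftrightarrow> red r \<in> P"
proof -
  obtain z where z: "r - red r = z * l" using l_dvd_diff_red[of r] by (auto simp: dvd_def mult.commute)
  have "r - red r \<in> P" unfolding z using assms by (intro ideal.subspace_scale)
  then show ?thesis
    using ideal.subspace_diff[OF assms(1), of r "r - red r"] ideal.subspace_add[OF assms(1), of "red r" "r - red r"]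
    by auto
qed

lemma prime_over_subset:
  assumes "ideal.subspace P" "l \<in> P" "p \<in> P" shows "prime_over p \<subseteq> P"
proof
  fix r assume "r \<in> prime_over p"
  then obtain z where "red r = z * p" by (auto simp: prime_over_def dvd_def mult.commute)
  then have "red r \<in> P" using assms ideal.subspace_scale by metis
  then show "r \<in> P" using mem_ideal_red assms by blast
qed

lemma prime_over_strict:
  assumes "irreducible p" "p \<in> polys_in (- {i})"
  shows "{0} \<subset> {r. l dvd r}" "{r. l dvd r} \<subset> prime_over p"
proof -
  have "l \<in> {r. l dvd r}" "l \<notin> {0}" "{0} \<subseteq> {r. l dvd r}" using l_nonzero by simp_all
  then show "{0} \<subset> {r. l dvd r}" by blast
  have "p \<in> prime_over p" using assms by (simp add: prime_over_def)
  moreover have "\<not> l dvd p" using assms by (auto simp: irreducible_def simp flip: red_eq_0_iff)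
  moreover have "{r. l dvd r} \<subseteq> prime_over p" by (auto simp: prime_over_def simp flip: red_eq_0_iff)
  ultimately show "{r. l dvd r} \<subset> prime_over p" by blast
qed

lemma height_gt_prime_over:
  assumes p: "irreducible p" "p \<in> polys_in (- {i})" and P: "prime_ideal P" "prime_over p \<subset> P"
  shows "3 \<le> height P"
proof -
  define C where "C j = (if j = 0 then {0} else if j = 1 then {r. l dvd r} else if j = 2 then prime_over p else P)"
    for j :: nat
  have "enat 3 \<le> height P"
  proof (rule height_ge[of _ C])
    show "prime_ideal (C j)" for j
      using prime_ideal_0 prime_ideal_l prime_over_prime_ideal p P by (auto simp: C_def)
    show "C j \<subset> C (Suc j)" if "j < 3" for j
    proof -
      consider "j = 0" | "j = 1" | "j = 2" using \<open>j < 3\<close> by linarith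
      then show ?thesis using prime_over_strict[OF p] P(2) by cases (auto simp: C_def numeral_2_eq_2)
    qed
  qed (simp add: C_def)
  then show ?thesis by (simp add: numeral_eq_enat)
qed

text \<open>A prime contains an irreducible factor \<open>p\<close> of \<open>red g\<close>, hence
  it contains \<open>prime_over p\<close>. Strict inclusion would extend the chain \<open>0\<close>,
  \<open>(l)\<close>, \<open>(l, p)\<close> and push the height to three.\<close>

lemma height_two_prime:
  assumes P: "prime_ideal P" "height P = 2" "l \<in> P" and g: "g \<in> P" "\<not> l dvd g"
  obtains p where "irreducible p" "p \<in> polys_in (- {i})" "P = prime_over p"
proof -
  have P': "ideal.subspace P" using P(1) by (simp add: prime_ideal_def)
  have g0: "red g \<noteq> 0" using g(2) by (simp add: red_eq_0_iff)
  have "red g \<in> P" using mem_ideal_red[OF P' P(3)] g(1) by blast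
  from prime_ideal_irreducible[OF P(1) this g0]
  obtain p where p: "irreducible p" "p dvd red g" "p \<in> P" by blast
  have pin: "p \<in> polys_in (- {i})" using polys_in_dvd[OF p(2) red_in g0] .
  have "prime_over p \<subseteq> P" using prime_over_subset P' P(3) p(3) by blast
  moreover have "\<not> prime_over p \<subset> P"
  proof
    assume "prime_over p \<subset> P"
    from height_gt_prime_over[OF p(1) pin P(1) this] P(2) have "(3::enat) \<le> 2" by simp
    then show False by simp
  qed
  ultimately show ?thesis using that p(1) pin by blast
qed

end

section \<open>Lengths of localizations\<close>

lemma loc_rel_equiv:
  assumes J: "ideal.subspace J" and P: "prime_ideal P"
  shows "equiv (UNIV \<times> (- P)) (loc_rel J P)"
proof (rule equivI)
  show "loc_rel J P \<subseteq> (UNIV \<times> (- P)) \<times> (UNIV \<times> (- P))" by (auto simp: loc_rel_def)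
  have "\<exists>u. u \<notin> P \<and> u * (s * a - s * a) \<in> J" for a s
    using prime_ideal_1[OF P] ideal.subspace_0[OF J] by auto
  then show "refl_on (UNIV \<times> (- P)) (loc_rel J P)" by (auto simp: refl_on_def loc_rel_def)
  show "sym (loc_rel J P)"
  proof (rule symI, clarify)
    fix a s b t assume "((a, s), (b, t)) \<in> loc_rel J P"
    then obtain u where u: "s \<notin> P" "t \<notin> P" "u \<notin> P" "u * (t * a - s * b) \<in> J" by (auto simp: loc_rel_def)
    then have "- (u * (t * a - s * b)) \<in> J" using ideal.subspace_neg[OF J] by blast
    then have "u * (s * b - t * a) \<in> J" by (simp add: right_diff_distrib)
    then show "((b, t), (a, s)) \<in> loc_rel J P" using u by (auto simp: loc_rel_def)
  qed
  show "trans (loc_rel J P)"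
  proof (rule transI, clarify)
    fix a s b t c r assume "((a, s), (b, t)) \<in> loc_rel J P" "((b, t), (c, r)) \<in> loc_rel J P"
    then obtain u v where u: "s \<notin> P" "t \<notin> P" "r \<notin> P" "u \<notin> P" "u * (t * a - s * b) \<in> J"
        "v \<notin> P" "v * (r * b - t * c) \<in> J" by (auto simp: loc_rel_def)
    have "(v * r) * (u * (t * a - s * b)) + (u * s) * (v * (r * b - t * c)) \<in> J"
      using ideal.subspace_add[OF J ideal.subspace_scale[OF J u(5)] ideal.subspace_scale[OF J u(7)]] .
    moreover have "(v * r) * (u * (t * a - s * b)) + (u * s) * (v * (r * b - t * c))
      = (u * v * t) * (r * a - s * c)" by (simp add: algebra_simps)
    ultimately have "(u * v * t) * (r * a - s * c) \<in> J" by simp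
    moreover have "u * v * t \<notin> P" using u prime_ideal_mult_iff[OF P] by blast
    ultimately show "((a, s), (c, r)) \<in> loc_rel J P" using u unfolding loc_rel_def by blast
  qed
qed

lemma loc_frac_eq_iff:
  assumes "ideal.subspace J" "prime_ideal P" "s \<notin> P" "t \<notin> P"
  shows "loc_frac J P a s = loc_frac J P b t \<longleftrightarrow> (\<exists>u. u \<notin> P \<and> u * (t * a - s * b) \<in> J)"
  unfolding loc_frac_def
  by (subst eq_equiv_class_iff[OF loc_rel_equiv]) (use assms in \<open>auto simp: loc_rel_def\<close>)

lemma loc_frac_in: "s \<notin> P \<Longrightarrow> loc_frac J P a s \<in> localization J P"
  unfolding loc_frac_def localization_def by (rule quotientI) auto

lemma localization_cases:
  assumes "x \<in> localization J P" obtains a s where "s \<notin> P" "x = loc_frac J P a s"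
  using assms unfolding localization_def loc_frac_def by (elim quotientE) auto

lemma irreducible_power_split:
  fixes p a :: "('n::finite, 'k::field) mpoly"
  assumes p: "irreducible p" and a: "a \<noteq> 0"
  shows "\<exists>k u. a = p ^ k * u \<and> \<not> p dvd u"
  using a
proof (induction "tdeg a" arbitrary: a rule: less_induct)
  case less
  show ?case
  proof (cases "p dvd a")
    case False
    then show ?thesis by (intro exI[of _ 0] exI[of _ a]) simp
  next
    case True
    then obtain b where b: "a = p * b" by (auto simp: dvd_def)
    have "p \<noteq> 0" "b \<noteq> 0" "tdeg p \<noteq> 0" using p less.prems b by (auto simp: irreducible_def mpoly_unit_iff)
    then have "tdeg b < tdeg a" using b tdeg_mult[of p b] by simp
    then obtain k u where "b = p ^ k * u" "\<not> p dvd u" using less.hyps \<open>b \<noteq> 0\<close> by blast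
    then show ?thesis using b by (intro exI[of _ "Suc k"] exI[of _ u]) (simp add: mult.assoc)
  qed
qed

lemma irreducible_power_dvd_cancel:
  fixes p u a :: "('n::finite, 'k::field) mpoly"
  assumes p: "irreducible p" and u: "\<not> p dvd u"
  shows "p ^ k dvd u * a \<Longrightarrow> p ^ k dvd a"
proof (induction k arbitrary: a)
  case (Suc k)
  have p0: "p \<noteq> 0" using p by (auto simp: irreducible_def)
  have "p dvd u * a" using Suc.prems by (metis dvd_mult_left power_Suc)
  then obtain b where b: "a = p * b" using irreducible_dvd_mult[OF p] u by (auto simp: dvd_def)
  then have "p * p ^ k dvd p * (u * b)" using Suc.prems by (simp add: mult.left_commute)
  then have "p ^ k dvd u * b" using mpoly_dvd_mult_cancel_left[OF p0] by blast
  then have "p ^ k dvd b" by (rule Suc.IH)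
  then show ?case by (simp add: b mpoly_dvd_mult_cancel_left[OF p0])
qed simp

context linear_form
begin

text \<open>Every submodule of the localization is generated by the class of a power of \<open>p\<close>, so a
  strict chain of submodules gives a strict chain of sets of exponents below \<open>m\<close>.\<close>

lemma local_length_le:
  assumes p: "irreducible p" and J: "ideal.subspace J" "l \<in> J"
    and s: "p ^ m * s \<in> J" "s \<notin> prime_over p"
  shows "local_length J (prime_over p) \<le> enat m"
proof -
  define P where "P = prime_over p"
  have P: "prime_ideal P" unfolding P_def using p by (rule prime_over_prime_ideal)
  have P1: "1 \<notin> P" using P by (rule prime_ideal_1)
  note eq_iff = loc_frac_eq_iff[OF J(1) P]
  define q where "q k = loc_frac J P (p ^ k) 1" for k
  \<comment> \<open>The element \<open>s\<close> is invertible in the localization, so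
    \<open>p ^ m * s \<in> J\<close> makes the class of \<open>p ^ m\<close> vanish.\<close>
  have zero: "q k = loc_frac J P 0 1" if "k \<ge> m" for k
  proof -
    have "p ^ (k - m) * (p ^ m * s) \<in> J" using J(1) s(1) by (rule ideal.subspace_scale)
    moreover have "p ^ k = p ^ (k - m) * p ^ m" using that by (simp flip: power_add)
    ultimately have "s * (1 * p ^ k - 1 * 0) \<in> J" by (simp add: ac_simps)
    then show ?thesis unfolding q_def using s(2) eq_iff[OF P1 P1] P_def by blast
  qed
  \<comment> \<open>An element is zero, or a unit times a power of \<open>p\<close>: split off the
    power from \<open>red a\<close> and use \<open>l \<in> J\<close>. The exponent does not depend
    on the submodule \<open>N\<close>, so membership can be compared along a chain.\<close>
  have mem: "(\<forall>N. loc_submodule J P N \<longrightarrow> loc_frac J P a t \<in> N) \<or>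
      (\<exists>k. \<forall>N. loc_submodule J P N \<longrightarrow> (loc_frac J P a t \<in> N \<longleftrightarrow> q k \<in> N))" if t: "t \<notin> P" for a t
  proof (cases "red a = 0")
    case True
    then obtain z where "a = z * l" by (auto simp: red_eq_0_iff dvd_def mult.commute)
    then have "a \<in> J" using J ideal.subspace_scale by metis
    then have "loc_frac J P a t = loc_frac J P 0 1"
      unfolding eq_iff[OF t P1] using P1 by (intro exI[of _ 1]) auto
    then show ?thesis by (auto simp: loc_submodule_def)
  next
    case False
    then obtain k u where ku: "red a = p ^ k * u" "\<not> p dvd u" using irreducible_power_split[OF p] by blast
    have "p ^ k * u \<in> polys_in (- {i})" "p ^ k * u \<noteq> 0" using red_in[of a] False ku by auto
    then have "u \<in> polys_in (- {i})" by (metis polys_in_dvd dvd_triv_right)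
    then have u: "u \<notin> P" using ku(2) by (simp add: P_def prime_over_def)
    obtain z where z: "a - p ^ k * u = z * l" using l_dvd_diff_red[of a] ku by (auto simp: dvd_def mult.commute)
    have zJ: "y * (a - p ^ k * u) \<in> J" for y
      unfolding z using J by (intro ideal.subspace_scale)
    have "loc_frac J P a t \<in> N \<longleftrightarrow> q k \<in> N" if N: "loc_submodule J P N" for N
    proof
      have sm: "loc_frac J P (r * a) (v * w) \<in> N" if "v \<notin> P" "w \<notin> P" "loc_frac J P a w \<in> N" for r v a w
        using N that unfolding loc_submodule_def by blast
      {
        assume "loc_frac J P a t \<in> N"
        then have "loc_frac J P (t * a) (u * t) \<in> N" using u t sm by blast
        moreover have "loc_frac J P (t * a) (u * t) = q k"
        proof -
          have "1 * (1 * (t * a) - (u * t) * p ^ k) = t * (a - p ^ k * u)" by (simp add: algebra_simps)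
          then have "1 * (1 * (t * a) - (u * t) * p ^ k) \<in> J" using zJ by simp
          moreover have "u * t \<notin> P" using u t prime_ideal_mult_iff[OF P] by blast
          ultimately show ?thesis unfolding q_def using eq_iff P1 by blast
        qed
        ultimately show "q k \<in> N" by simp
      }
      assume "q k \<in> N"
      then have "loc_frac J P (u * p ^ k) (t * 1) \<in> N" unfolding q_def using t P1 sm by blast
      moreover have "loc_frac J P (u * p ^ k) (t * 1) = loc_frac J P a t"
      proof -
        have "1 * (t * (u * p ^ k) - (t * 1) * a) = (- t) * (a - p ^ k * u)" by (simp add: algebra_simps)
        then have "1 * (t * (u * p ^ k) - (t * 1) * a) \<in> J" by (simp only: zJ)
        moreover have "t * 1 \<notin> P" using t by simp
        ultimately show ?thesis using eq_iff t P1 by blast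
      qed
      ultimately show "loc_frac J P a t \<in> N" by simp
    qed
    then show ?thesis by blast
  qed
  \<comment> \<open>Exponents from \<open>m\<close> on give zero and lie in every submodule; only
    those below \<open>m\<close> can tell two submodules apart.\<close>
  define E where "E N = {k. k < m \<and> q k \<in> N}" for N
  have E: "E N \<subset> E N'" if N: "loc_submodule J P N" "loc_submodule J P N'" "N \<subset> N'" for N N'
  proof -
    obtain x where x: "x \<in> N'" "x \<notin> N" using N(3) by blast
    have "x \<in> localization J P" using x(1) N(2) unfolding loc_submodule_def by blast
    then obtain a t where a: "t \<notin> P" "x = loc_frac J P a t" by (rule localization_cases)
    then obtain k where k: "q k \<in> N'" "q k \<notin> N" using mem[OF a(1), of a] N x by blast
    moreover have "k < m"
    proof (rule ccontr)
      assume "\<not> k < m"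
      then have "q k = loc_frac J P 0 1" by (intro zero) simp
      then show False using k(2) N(1) by (simp add: loc_submodule_def)
    qed
    moreover have "E N \<subseteq> E N'" using N(3) by (auto simp: E_def)
    ultimately show ?thesis by (auto simp: E_def)
  qed
  have bound: "k \<le> m" if C: "\<And>j. j \<le> k \<Longrightarrow> loc_submodule J P (C j)" "\<And>j. j < k \<Longrightarrow> C j \<subset> C (Suc j)" for k C
  proof -
    have fin: "finite (E N)" for N by (simp add: E_def)
    have "j \<le> card (E (C j))" if "j \<le> k" for j
      using that
    proof (induction j)
      case (Suc j)
      then have "E (C j) \<subset> E (C (Suc j))" using C by (intro E) auto
      then have "card (E (C j)) < card (E (C (Suc j)))" using fin by (rule psubset_card_mono[rotated])
      with Suc show ?case by simp
    qed simp
    then have "k \<le> card (E (C k))" by simp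
    also have "\<dots> \<le> card {..<m}" by (rule card_mono) (auto simp: E_def)
    finally show ?thesis by simp
  qed
  show ?thesis
    unfolding local_length_def P_def[symmetric]
  proof (rule Sup_least, clarify)
    fix k C assume "\<forall>j\<le>k. loc_submodule J P (C j)" "\<forall>j<k. C j \<subset> C (Suc j)"
    then show "enat k \<le> enat m" using bound[of k C] by simp
  qed
qed

text \<open>The chain consists of the multiples of \<open>p ^ m\<close>, \<open>p ^ (m - 1)\<close>,
  and so on up to \<open>p ^ 0\<close>, in the localization.\<close>

lemma local_length_ge:
  assumes p: "irreducible p" "p \<in> polys_in (- {i})" and J: "ideal.subspace J" "\<And>g. g \<in> J \<Longrightarrow> p ^ m dvd red g"
  shows "enat m \<le> local_length J (prime_over p)"
proof -
  define P where "P = prime_over p"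
  have P: "prime_ideal P" unfolding P_def using p(1) by (rule prime_over_prime_ideal)
  have P1: "1 \<notin> P" using P by (rule prime_ideal_1)
  have p0: "p \<noteq> 0" using p by (auto simp: irreducible_def)
  note eq_iff = loc_frac_eq_iff[OF J(1) P]
  note mult_iff = prime_ideal_mult_iff[OF P]
  define N where "N j = {loc_frac J P a s | a s. s \<notin> P \<and> p ^ (m - j) dvd red a}" for j
  \<comment> \<open>This is independence of the representative: equal fractions differ by an element
    of \<open>J\<close> after multiplication by elements outside \<open>P\<close>, and every residue
    of \<open>J\<close> is divisible by \<open>p ^ m\<close>.\<close>
  have mem: "loc_frac J P a s \<in> N j \<longleftrightarrow> p ^ (m - j) dvd red a" if s: "s \<notin> P" for a s j
  proof
    assume "loc_frac J P a s \<in> N j"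
    then obtain b t where b: "t \<notin> P" "p ^ (m - j) dvd red b" "loc_frac J P a s = loc_frac J P b t"
      by (auto simp: N_def)
    then obtain u where u: "u \<notin> P" "u * (t * a - s * b) \<in> J" using eq_iff s by blast
    have "p ^ (m - j) dvd red (u * (t * a - s * b))"
      using J(2)[OF u(2)] le_imp_power_dvd[of "m - j" m p] dvd_trans by auto
    moreover have "red (u * (t * a - s * b)) = red (u * t) * red a - (red u * red s) * red b"
      by (simp add: red_mult red_diff algebra_simps)
    ultimately have "p ^ (m - j) dvd (red (u * t) * red a - (red u * red s) * red b) + (red u * red s) * red b"
      using b(2) by (intro dvd_add) auto
    then have "p ^ (m - j) dvd red (u * t) * red a" by simp
    moreover have "\<not> p dvd red (u * t)" using u b mult_iff[of u t] by (simp add: P_def prime_over_def)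
    ultimately show "p ^ (m - j) dvd red a" using irreducible_power_dvd_cancel[OF p(1)] by blast
  next
    assume "p ^ (m - j) dvd red a"
    then show "loc_frac J P a s \<in> N j" using s unfolding N_def by blast
  qed
  have "loc_submodule J P (N j)" for j
    unfolding loc_submodule_def
  proof (intro conjI allI impI)
    show "N j \<subseteq> localization J P" by (auto simp: N_def intro: loc_frac_in)
    show "loc_frac J P 0 1 \<in> N j" by (simp add: mem P1)
    fix a s b t assume "s \<notin> P" "t \<notin> P" "loc_frac J P a s \<in> N j" "loc_frac J P b t \<in> N j"
    moreover from this have "s * t \<notin> P" by (simp add: mult_iff)
    ultimately show "loc_frac J P (t * a + s * b) (s * t) \<in> N j" by (simp add: mem red_add red_mult)
  next
    fix r u a s assume "u \<notin> P" "s \<notin> P" "loc_frac J P a s \<in> N j"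
    moreover from this have "u * s \<notin> P" by (simp add: mult_iff)
    ultimately show "loc_frac J P (r * a) (u * s) \<in> N j" by (simp add: mem red_mult)
  qed
  moreover have "N j \<subset> N (Suc j)" if "j < m" for j
  proof -
    have m: "m - j = Suc (m - Suc j)" using that by simp
    have "N j \<subseteq> N (Suc j)" unfolding N_def m by (auto intro: dvd_mult_right)
    moreover have "loc_frac J P (p ^ (m - Suc j)) 1 \<in> N (Suc j)" by (simp add: mem P1 red_power p)
    moreover have "loc_frac J P (p ^ (m - Suc j)) 1 \<notin> N j"
    proof
      assume "loc_frac J P (p ^ (m - Suc j)) 1 \<in> N j"
      then have "p ^ (m - Suc j) * p dvd p ^ (m - Suc j) * 1" by (simp add: mem P1 red_power p m mult.commute)
      moreover have "p ^ (m - Suc j) \<noteq> 0" using p0 by simp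
      ultimately have "p dvd 1" using mpoly_dvd_mult_cancel_left by blast
      then show False using p by (simp add: irreducible_def)
    qed
    ultimately show ?thesis by blast
  qed
  ultimately show ?thesis unfolding local_length_def P_def[symmetric] by (intro Sup_upper) blast
qed

end

section \<open>Hilbert functions\<close>

definition monomials :: "'n::finite set \<Rightarrow> nat \<Rightarrow> ('n \<Rightarrow>\<^sub>0 nat) set" where
  "monomials A m = {u. keys u \<subseteq> A \<and> mdeg u = m}"

lemma monomials_0: "monomials A 0 = {0}"
  by (auto simp: monomials_def)

lemma monomials_empty: "monomials {} (Suc m) = {}"
  by (auto simp: monomials_def)

lemma monomials_insert_Suc:
  assumes "i \<notin> A"
  shows "monomials (insert i A) (Suc m)
    = monomials A (Suc m) \<union> (\<lambda>v. v + Poly_Mapping.single i 1) ` monomials (insert i A) m"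
proof (intro equalityI subsetI)
  fix u assume u: "u \<in> monomials (insert i A) (Suc m)"
  show "u \<in> monomials A (Suc m) \<union> (\<lambda>v. v + Poly_Mapping.single i 1) ` monomials (insert i A) m"
  proof (cases "i \<in> keys u")
    case False
    then show ?thesis using u by (auto simp: monomials_def)
  next
    case True
    define v where "v = u - Poly_Mapping.single i 1"
    have uv: "u = v + Poly_Mapping.single i 1"
      using True unfolding v_def
      by (intro poly_mapping_eqI) (auto simp: lookup_add lookup_minus lookup_single when_def in_keys_iff)
    have "mdeg v = m" using u arg_cong[OF uv, of mdeg] by (simp add: monomials_def mdeg_add)
    moreover have "keys v \<subseteq> keys u" by (auto simp: v_def in_keys_iff lookup_minus)
    ultimately have "v \<in> monomials (insert i A) m" using u by (auto simp: monomials_def)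
    then show ?thesis using uv by blast
  qed
next
  fix u assume "u \<in> monomials A (Suc m) \<union> (\<lambda>v. v + Poly_Mapping.single i 1) ` monomials (insert i A) m"
  then show "u \<in> monomials (insert i A) (Suc m)"
    by (auto simp: monomials_def mdeg_add keys_add_nat)
qed

lemma finite_monomials [simp]: "finite (monomials A m)"
proof -
  have "finite A" by simp
  then show ?thesis
  proof (induction A arbitrary: m)
    case empty
    then show ?case by (cases m) (auto simp: monomials_0 monomials_empty)
  next
    case (insert i A)
    show ?case by (induction m) (auto simp: monomials_0 monomials_insert_Suc[OF insert.hyps(2)] insert.IH)
  qed
qed

lemma card_monomials_insert_Suc:
  assumes "i \<notin> A"
  shows "card (monomials (insert i A) (Suc m)) = card (monomials A (Suc m)) + card (monomials (insert i A) m)"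
proof -
  let ?g = "\<lambda>v :: 'a \<Rightarrow>\<^sub>0 nat. v + Poly_Mapping.single i 1"
  have "i \<in> keys (?g v)" for v by (simp add: keys_add_nat)
  moreover have "i \<notin> keys u" if "u \<in> monomials A (Suc m)" for u using that assms by (auto simp: monomials_def)
  ultimately have "monomials A (Suc m) \<inter> ?g ` monomials (insert i A) m = {}" by blast
  moreover have "card (?g ` monomials (insert i A) m) = card (monomials (insert i A) m)"
    by (rule card_image) (auto simp: inj_on_def)
  ultimately show ?thesis by (simp add: monomials_insert_Suc[OF assms] card_Un_disjoint)
qed

text \<open>Stars and bars. A monomial either avoids the new variable or is a multiple of it, which
  is Pascal's rule for the binomial coefficients.\<close>

lemma card_monomials:
  assumes "card A = Suc r" shows "card (monomials A m) = (m + r) choose r"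
proof -
  have "finite A" by simp
  then show ?thesis using assms
  proof (induction A arbitrary: r m)
    case (insert i A)
    show ?case
    proof (cases r)
      case 0
      then have [simp]: "A = {}" using insert by simp
      have "card (monomials {i} m) = 1"
      proof (induction m)
        case (Suc m)
        then show ?case using card_monomials_insert_Suc[of i "{}" m] by (simp add: monomials_empty)
      qed (simp add: monomials_0)
      then show ?thesis using 0 by simp
    next
      case (Suc r')
      then have A: "card A = Suc r'" using insert by simp
      show ?thesis
      proof (induction m)
        case 0
        then show ?case by (simp add: monomials_0)
      next
        case (Suc m)
        then show ?case using insert.IH[OF A, of "Suc m"] \<open>r = Suc r'\<close>
          by (simp add: card_monomials_insert_Suc[OF insert.hyps(2)])
      qed
    qed
  qed simp
qed

lemma mscale_const: "mscale c p = const c * p"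
  by (simp add: mscale_def const_def)

text \<open>The basis is an indexed family rather than a set, so generators of different kinds can
  be indexed by a sum type; their distinctness follows from the independence hypothesis.\<close>

lemma dim_of_family:
  fixes b :: "'s \<Rightarrow> ('n::finite, 'k::field) mpoly"
  assumes S: "finite S" and V: "\<And>x. x \<in> V \<longleftrightarrow> (\<exists>c. x = (\<Sum>s\<in>S. const (c s) * b s))"
    and ind: "\<And>c s. (\<Sum>s\<in>S. const (c s) * b s) = 0 \<Longrightarrow> s \<in> S \<Longrightarrow> c s = 0"
  shows "mpoly.dim V = card S"
proof (rule mpoly.dim_unique)
  have single: "(\<Sum>s\<in>S. const (if s = t then x else 0) * b s) = const x * b t" if "t \<in> S" for t x
  proof -
    have "(\<Sum>s\<in>S. const (if s = t then x else 0) * b s) = (\<Sum>s\<in>S. if s = t then const x * b t else 0)"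
      by (intro sum.cong) auto
    then show ?thesis using that S by simp
  qed
  have inj: "inj_on b S"
  proof (rule inj_onI, rule ccontr)
    fix s t assume st: "s \<in> S" "t \<in> S" "b s = b t" "s \<noteq> t"
    \<comment> \<open>Two equal members would satisfy the relation with coefficients
      \<open>1\<close> and \<open>-1\<close>.\<close>
    have "(\<Sum>x\<in>S. const ((if x = s then 1 else 0) - (if x = t then 1 else 0)) * b x)
      = (\<Sum>x\<in>S. const (if x = s then 1 else 0) * b x) - (\<Sum>x\<in>S. const (if x = t then 1 else 0) * b x)"
      unfolding sum_subtractf[symmetric] by (intro sum.cong refl) (simp add: const_def single_diff left_diff_distrib)
    also have "\<dots> = 0" using single[OF st(1), of 1] single[OF st(2), of 1] st(3) by simp
    finally show False using ind[of _ s] st by fastforce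
  qed
  show "b ` S \<subseteq> V"
    using single[of _ 1] by (auto simp: V const_1) metis
  show "V \<subseteq> mpoly.span (b ` S)"
  proof
    fix x assume "x \<in> V"
    then obtain c where x: "x = (\<Sum>s\<in>S. mscale (c s) (b s))" by (auto simp: V mscale_const)
    show "x \<in> mpoly.span (b ` S)"
      unfolding x by (rule mpoly.span_sum, rule mpoly.span_scale, rule mpoly.span_base) simp
  qed
  show "mpoly.independent (b ` S)"
  proof (rule mpoly.independent_if_scalars_zero)
    fix f x assume "(\<Sum>x\<in>b ` S. mscale (f x) x) = 0" "x \<in> b ` S"
    then show "f x = 0" using ind[of "f \<circ> b"] by (auto simp: sum.reindex[OF inj] mscale_const)
  qed (use S in auto)
  show "card (b ` S) = card S" by (rule card_image[OF inj])
qed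

lemma form_sum_monomials:
  assumes "F \<in> forms (int m)" "F \<in> polys_in A"
  shows "F = (\<Sum>u\<in>monomials A m. const (lookup F u) * Poly_Mapping.single u 1)"
proof -
  have "F = (\<Sum>u\<in>monomials A m. Poly_Mapping.single u (lookup F u))"
    by (rule sum_single_lookup[OF finite_monomials]) (use assms in \<open>auto simp: monomials_def forms_def polys_in_def supported_def\<close>)
  then show ?thesis by (simp add: const_def mult_single)
qed

lemma sum_monomials_form:
  "(\<Sum>u\<in>monomials A m. const (c u) * Poly_Mapping.single u 1) \<in> forms (int m)"
  "(\<Sum>u\<in>monomials A m. const (c u) * Poly_Mapping.single u 1) \<in> polys_in A"
  unfolding forms_supported polys_in_def
  by (intro supported_sum; auto simp: const_def mult_single supported_def monomials_def)+

lemma sum_monomials_eq_0: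
  assumes "(\<Sum>u\<in>monomials A m. const (c u) * Poly_Mapping.single u 1) = 0" "v \<in> monomials A m"
  shows "c v = 0"
proof -
  have "lookup (\<Sum>u\<in>monomials A m. const (c u) * Poly_Mapping.single u 1) v
      = (\<Sum>u\<in>monomials A m. if u = v then c v else 0)"
    unfolding lookup_sum by (intro sum.cong) (auto simp: const_def mult_single lookup_single when_def)
  then show ?thesis using assms by simp
qed

lemma dim_forms: "mpoly.dim (forms (int m) :: ('n::finite, 'k::field) mpoly set) = card (monomials (UNIV :: 'n set) m)"
proof (rule dim_of_family[where b = "\<lambda>u. Poly_Mapping.single u 1"])
  show "x \<in> forms (int m) \<longleftrightarrow> (\<exists>c. x = (\<Sum>s\<in>monomials UNIV m. const (c s) * Poly_Mapping.single s 1))"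
    for x :: "('n, 'k) mpoly"
    using form_sum_monomials[of x m UNIV] sum_monomials_form(1)[of _ UNIV m] by auto
qed (auto intro: sum_monomials_eq_0)

context linear_form
begin

text \<open>A form of degree \<open>m\<close> in the ideal is uniquely \<open>l * q + p * g\<close>
  with \<open>g\<close> free of \<open>x\<^sub>i\<close>; this restriction on \<open>g\<close>
  removes the Koszul relation between \<open>l\<close> and \<open>p\<close>.\<close>

lemma dim_prime_over_forms:
  assumes p: "irreducible p" "p \<in> polys_in (- {i})" "p \<in> forms (int d)" and m: "d \<le> m" "1 \<le> m"
  shows "mpoly.dim (prime_over p \<inter> forms (int m)) = card (monomials (UNIV :: 'n set) (m - 1)) + card (monomials (- {i}) (m - d))"
proof -
  let ?S = "monomials (UNIV :: 'n set) (m - 1) <+> monomials (- {i}) (m - d)"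
  let ?m = "\<lambda>u. Poly_Mapping.single u 1"
  let ?b = "case_sum (\<lambda>u. l * ?m u) (\<lambda>v. p * ?m v)"
  define F where "F c = (\<Sum>u\<in>monomials (UNIV :: 'n set) (m - 1). const (c (Inl u)) * ?m u)"
    for c :: "('n \<Rightarrow>\<^sub>0 nat) + ('n \<Rightarrow>\<^sub>0 nat) \<Rightarrow> 'k"
  define G where "G c = (\<Sum>v\<in>monomials (- {i}) (m - d). const (c (Inr v)) * ?m v)"
    for c :: "('n \<Rightarrow>\<^sub>0 nat) + ('n \<Rightarrow>\<^sub>0 nat) \<Rightarrow> 'k"
  have p0: "p \<noteq> 0" using p by (auto simp: irreducible_def)
  have sum: "(\<Sum>s\<in>?S. const (c s) * ?b s) = l * F c + p * G c" for c
    by (simp add: sum.Plus F_def G_def sum_distrib_left ac_simps)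
  have FG: "F c \<in> forms (int m - 1)" "G c \<in> forms (int m - int d)" "G c \<in> polys_in (- {i})" for c
    using sum_monomials_form[of _ UNIV "m - 1"] sum_monomials_form[of _ "- {i}" "m - d"] m
    by (simp_all add: F_def G_def of_nat_diff)
  have "mpoly.dim (prime_over p \<inter> forms (int m)) = card ?S"
  proof (rule dim_of_family[where b = ?b])
    fix x
    show "x \<in> prime_over p \<inter> forms (int m) \<longleftrightarrow> (\<exists>c. x = (\<Sum>s\<in>?S. const (c s) * ?b s))"
    proof
      assume x: "x \<in> prime_over p \<inter> forms (int m)"
      obtain q b where qb: "b \<in> polys_in (- {i})" "x = q * l + b" "q \<in> forms (int m - 1)" "b \<in> forms (int m)"
        using division[of x] x by (metis IntD2)
      have "red x = b" using qb by (intro red_eqI) auto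
      then obtain g where g: "b = p * g" using x by (auto simp: prime_over_def dvd_def)
      have g': "g \<in> forms (int m - int d) \<and> g \<in> polys_in (- {i})"
      proof (cases "b = 0")
        case True
        then show ?thesis using g p0 by simp
      next
        case False
        then have "g dvd b" "b \<noteq> 0" "g \<noteq> 0" using g by auto
        then have g: "g \<in> forms (int (tdeg g))" "g \<in> polys_in (- {i})"
          using forms_dvd qb(4) polys_in_dvd qb(1) by blast+
        have "int m = int d + int (tdeg g)"
          using forms_unique[OF qb(4) _ False] forms_mult[OF p(3) g(1)] \<open>b = p * g\<close> by simp
        then show ?thesis using g by simp
      qed
      define c where "c = case_sum (lookup q) (lookup g)"
      have "F c = q" using form_sum_monomials[of q "m - 1" UNIV] qb(3) m by (simp add: F_def c_def of_nat_diff)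
      moreover have "G c = g" using form_sum_monomials[of g "m - d" "- {i}"] g' m by (simp add: G_def c_def of_nat_diff)
      ultimately show "\<exists>c. x = (\<Sum>s\<in>?S. const (c s) * ?b s)"
        unfolding sum using qb(2) g by (intro exI[of _ c]) (simp add: mult.commute)
    next
      assume "\<exists>c. x = (\<Sum>s\<in>?S. const (c s) * ?b s)"
      then obtain c where x: "x = l * F c + p * G c" unfolding sum by blast
      have "x \<in> forms (int m)"
        unfolding x using forms_mult[OF l_form FG(1)] forms_mult[OF p(3) FG(2)] by (intro forms_add) simp_all
      moreover have "p dvd red x" unfolding x by (simp add: red_add red_mult p(2))
      ultimately show "x \<in> prime_over p \<inter> forms (int m)" by (simp add: prime_over_def)
    qed
  next
    fix c s assume c: "(\<Sum>s\<in>?S. const (c s) * ?b s) = 0" and s: "s \<in> ?S"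
    have eq: "l * F c + p * G c = 0" using c unfolding sum .
    \<comment> \<open>Reduction kills the multiple of \<open>l\<close> and fixes
      \<open>p * G c\<close>, so the two kinds of generators are independent of each other.\<close>
    then have "red (l * F c + p * G c) = 0" by simp
    then have G0: "G c = 0" using p0 FG(3)[of c] by (simp add: red_add red_mult p(2))
    then have F0: "F c = 0" using eq l_nonzero by simp
    show "c s = 0"
      using s sum_monomials_eq_0[OF F0[unfolded F_def]] sum_monomials_eq_0[OF G0[unfolded G_def]] by auto
  qed simp
  then show ?thesis by (simp add: card_Plus)
qed

text \<open>Eliminating \<open>x\<^sub>i\<close> leaves \<open>r + 1\<close> variables, and Pascal's
  rule merges the contributions of all monomials and of the multiples of \<open>l\<close>. The
  result is the Hilbert function of a hypersurface of degree \<open>d\<close>.\<close>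

lemma hilbert_function_prime_over:
  assumes p: "irreducible p" "p \<in> polys_in (- {i})" "p \<in> forms (int d)" and m: "d \<le> m" "1 \<le> m"
    and n: "CARD('n) = Suc (Suc r)"
  shows "hilbert_function (prime_over p) m = ((m + r) choose r) - ((m - d + r) choose r)"
proof -
  obtain m' where m': "m = Suc m'" using m(2) by (cases m) auto
  have "card (monomials (UNIV :: 'n set) m) = (m + Suc r) choose Suc r"
    "card (monomials (UNIV :: 'n set) (m - 1)) = (m - 1 + Suc r) choose Suc r"
    by (rule card_monomials[OF n])+
  moreover have "card (monomials (- {i}) (m - d)) = (m - d + r) choose r"
    using n by (intro card_monomials) (simp add: Compl_eq_Diff_UNIV card_Diff_subset)
  ultimately show ?thesis
    unfolding hilbert_function_def dim_prime_over_forms[OF p m] dim_forms by (simp add: m')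
qed

end

text \<open>This is the binomial coefficient \<open>(m + r) choose r\<close> as a polynomial in
  \<open>m\<close>.\<close>

primrec binomial_poly :: "nat \<Rightarrow> rat poly" where
  "binomial_poly 0 = 1"
| "binomial_poly (Suc r) = smult (1 / of_nat (Suc r)) ([:of_nat (Suc r), 1:] * binomial_poly r)"

lemma poly_binomial_poly: "poly (binomial_poly r) (of_nat m) = of_nat ((m + r) choose r)"
proof (induction r)
  case (Suc r)
  have "(of_nat (Suc r) :: rat) * of_nat ((m + Suc r) choose Suc r) = of_nat (Suc (m + r)) * of_nat ((m + r) choose r)"
    unfolding of_nat_mult[symmetric] using Suc_times_binomial_eq[of "m + r" r] by (simp add: mult.commute)
  then have "(of_nat ((m + Suc r) choose Suc r) :: rat) = of_nat (Suc (m + r)) * of_nat ((m + r) choose r) / of_nat (Suc r)"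
    by (simp add: field_simps del: of_nat_Suc binomial_Suc_Suc)
  also have "\<dots> = poly (binomial_poly (Suc r)) (of_nat m)"
    by (simp add: Suc algebra_simps add_divide_distrib)
  finally show ?case ..
qed simp

lemma binomial_poly_lead: "degree (binomial_poly r) = r \<and> lead_coeff (binomial_poly r) = 1 / fact r"
proof (induction r)
  case (Suc r)
  then have "binomial_poly r \<noteq> 0" by auto
  moreover have "[:of_nat (Suc r), 1 :: rat:] \<noteq> 0" by simp
  ultimately have "degree ([:of_nat (Suc r), 1:] * binomial_poly r) = Suc r"
    using Suc by (subst degree_mult_eq) auto
  moreover have "lead_coeff ([:of_nat (Suc r), 1:] * binomial_poly r) = 1 / fact r"
    using Suc by (subst lead_coeff_mult) auto
  ultimately show ?case by (simp del: mult_pCons_left of_nat_Suc)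
qed simp

text \<open>Telescoping with Pascal's rule. A difference whose leading terms cancel becomes a sum of
  \<open>d\<close> terms of degree \<open>q\<close> in \<open>m\<close>, all with the same leading
  coefficient.\<close>

lemma binomial_diff:
  assumes "d \<le> m"
  shows "((m + Suc q) choose Suc q) - ((m - d + Suc q) choose Suc q) = (\<Sum>t<d. (m - t + q) choose q)"
proof -
  have "(m + Suc q) choose Suc q = ((m - d + Suc q) choose Suc q) + (\<Sum>t<d. (m - t + q) choose q)"
    using assms
  proof (induction d)
    case (Suc d)
    then have "m - d = Suc (m - Suc d)" "m + q - d = Suc (m + q - Suc d)" by simp_all
    then show ?case using Suc by simp
  qed simp
  then show ?thesis by simp
qed

lemma poly_eq_eventually:
  fixes p q :: "rat poly"
  assumes "\<forall>\<^sub>F m in sequentially. poly p (of_nat m) = poly q (of_nat m)"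
  shows "p = q"
proof (rule ccontr)
  assume "p \<noteq> q"
  then have "finite {x. poly (p - q) x = 0}" by (intro poly_roots_finite) simp
  moreover obtain M where "\<And>m. m \<ge> M \<Longrightarrow> poly p (of_nat m) = poly q (of_nat m)"
    using assms by (auto simp: eventually_sequentially)
  then have "of_nat ` {M..} \<subseteq> {x. poly (p - q) x = 0}" by auto
  ultimately have "finite (of_nat ` {M..} :: rat set)" by (rule finite_subset[rotated])
  then have "finite {M..}" by (rule finite_imageD) (auto simp: inj_on_def)
  then show False using infinite_Ici by blast
qed

lemma hilbert_polynomial_eqI:
  assumes "\<forall>\<^sub>F m in sequentially. poly H (of_nat m) = of_nat (hilbert_function I m)"
  shows "hilbert_polynomial I = H"
  unfolding hilbert_polynomial_def
proof (rule the_equality)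
  show "\<forall>\<^sub>F m in sequentially. poly H (of_nat m) = of_nat (hilbert_function I m)" by (rule assms)
  fix H' :: "rat poly" assume "\<forall>\<^sub>F m in sequentially. poly H' (of_nat m) = of_nat (hilbert_function I m)"
  then show "H' = H" using assms by (intro poly_eq_eventually) (auto elim: eventually_elim2)
qed

lemma (in linear_form) hilbert_degree_prime_over:
  assumes p: "irreducible p" "p \<in> polys_in (- {i})" "p \<in> forms (int d)" and n: "CARD('n) \<ge> 3"
  shows "hilbert_degree (prime_over p) = of_nat d"
proof -
  \<comment> \<open>The degree of the Hilbert polynomial will be \<open>q\<close>, the number of
    variables minus three.\<close>
  obtain q where q: "CARD('n) = Suc (Suc (Suc q))"
    using n by (metis Suc_le_D numeral_3_eq_3 add_Suc_right le_Suc_ex plus_nat.simps)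
  have d: "d \<ge> 1"
  proof (rule ccontr)
    assume "\<not> d \<ge> 1"
    then have "d = 0" by simp
    then have "p \<in> forms 0" using p(3) by simp
    then obtain c where "p = const c" by (rule forms_0_const)
    then show False using p(1) by (auto simp: irreducible_def mpoly_unit_iff)
  qed
  \<comment> \<open>The shift by \<open>t\<close> turns \<open>binomial_poly q\<close> into the
    \<open>t\<close>-th summand of \<open>binomial_diff\<close>, without changing its leading
    coefficient \<open>1 / fact q\<close>.\<close>
  define h where "h t = binomial_poly q \<circ>\<^sub>p [:- of_nat t, 1:]" for t :: nat
  define H where "H = (\<Sum>t<d. h t)"
  have "poly H (of_nat m) = of_nat (hilbert_function (prime_over p) m)" if m: "m \<ge> d" for m
  proof -
    have "hilbert_function (prime_over p) m = (\<Sum>t<d. (m - t + q) choose q)"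
      unfolding hilbert_function_prime_over[OF p m order_trans[OF d m] q] using m by (rule binomial_diff)
    moreover have "poly (h t) (of_nat m) = of_nat ((m - t + q) choose q)" if "t < d" for t
      using poly_binomial_poly[of q "m - t"] that m by (simp add: h_def poly_pcompose of_nat_diff)
    ultimately show ?thesis by (simp add: H_def poly_sum)
  qed
  then have H: "hilbert_polynomial (prime_over p) = H"
    by (intro hilbert_polynomial_eqI) (auto simp: eventually_sequentially)
  have h: "degree (h t) = q" "coeff (h t) q = 1 / fact q" for t
  proof -
    show deg: "degree (h t) = q" using binomial_poly_lead[of q] by (simp add: h_def degree_pcompose)
    have "lead_coeff (h t) = 1 / fact q"
      using binomial_poly_lead[of q] by (auto simp: h_def lead_coeff_comp)
    then show "coeff (h t) q = 1 / fact q" by (simp add: deg)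
  qed
  have c: "coeff H q = of_nat d / fact q" by (simp add: H_def coeff_sum h)
  have "degree H \<le> q" unfolding H_def by (rule degree_sum_le) (auto simp: h)
  moreover have "coeff H q \<noteq> 0" using c d by simp
  ultimately have "degree H = q" using le_degree by (metis le_antisym)
  then show ?thesis using c by (simp add: hilbert_degree_def H)
qed

section \<open>Height two primes generated by two variables\<close>

lemma irreducible_linear_form:
  fixes p :: "('n::finite, 'k::field) mpoly"
  assumes "p \<in> forms 1" "p \<noteq> 0" shows "irreducible p"
proof -
  have p: "tdeg p = 1" using assms by (intro forms_tdeg) auto
  have "a dvd 1 \<or> b dvd 1" if "p = a * b" for a b
  proof -
    have "a \<noteq> 0" "b \<noteq> 0" using assms(2) that by auto
    then have "tdeg a + tdeg b = 1" using p that by (simp add: tdeg_mult)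
    then show ?thesis using \<open>a \<noteq> 0\<close> \<open>b \<noteq> 0\<close> by (auto simp: mpoly_unit_iff)
  qed
  then show ?thesis using assms(2) p by (auto simp: irreducible_def mpoly_unit_iff)
qed

lemma var_nonzero [simp]: "var i \<noteq> 0"
  by (metis ComplI polys_in_0 polys_in_var singletonI ComplD)

lemma irreducible_var: "irreducible (var i :: ('n::finite, 'k::field) mpoly)"
  by (intro irreducible_linear_form forms_var var_nonzero)

lemma linear_form_var: "linear_form (var i :: ('n::finite, 'k::field) mpoly) i"
  by unfold_locales (auto simp: forms_var)

lemma var_dvd_if_supported:
  fixes p :: "('n, 'k::field) mpoly"
  assumes "p \<in> supported {u. i \<in> keys u}" shows "var i dvd p"
proof -
  have "\<exists>w\<in>UNIV. u = w + Poly_Mapping.single i 1" if "u \<in> {u. i \<in> keys u}" for u :: "'n \<Rightarrow>\<^sub>0 nat"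
  proof
    show "u = (u - Poly_Mapping.single i 1) + Poly_Mapping.single i 1"
      using that
      by (intro poly_mapping_eqI) (auto simp: lookup_add lookup_minus lookup_single when_def in_keys_iff)
  qed simp
  with assms obtain q where "p = q * Poly_Mapping.single (Poly_Mapping.single i 1) 1"
    by (rule supported_div_monomial)
  then show ?thesis by (simp add: var_def)
qed

lemma prime_ideal_power:
  assumes "prime_ideal P" "a ^ k \<in> P" shows "a \<in> P"
  using assms(2)
proof (induction k)
  case 0
  then show ?case using prime_ideal_1[OF assms(1)] by simp
next
  case (Suc k)
  then show ?case using prime_ideal_mult_iff[OF assms(1)] by auto
qed

text \<open>Eliminating \<open>x\<^sub>j\<close> from two coprime elements of \<open>Q\<close> leaves an element \<open>x\<^sub>i\<^sup>k w\<close> of \<open>Q\<close> with \<open>w\<close>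
  outside the ideal \<open>(x\<^sub>i, x\<^sub>j)\<close>.\<close>

lemma prime_ideal_contains_var:
  fixes Q :: "('n::finite, 'k::field) mpoly set"
  assumes Q: "prime_ideal Q" "Q \<subseteq> supported {u. i \<in> keys u \<or> j \<in> keys u}"
    and pg: "irreducible p" "p \<in> Q" "g \<in> Q" "\<not> p dvd g"
  shows "var i \<in> Q"
proof -
  have Q': "ideal.subspace Q" using Q(1) by (simp add: prime_ideal_def)
  obtain u v c where c: "c = u * p + v * g" "c \<noteq> 0" "c \<in> polys_in (- {j})"
    using elimination[OF pg(1,4)] .
  have "c \<in> Q" unfolding c(1) using pg(2,3) Q'
    by (intro ideal.subspace_add[OF Q'] ideal.subspace_scale[OF Q'])
  obtain k w where w: "c = var i ^ k * w" "\<not> var i dvd w"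
    using irreducible_power_split[OF irreducible_var c(2)] by blast
  have "w dvd c" unfolding w(1) by simp
  then have "w \<in> polys_in (- {j})" using c(3,2) by (rule polys_in_dvd)
  \<comment> \<open>Every monomial of an element of \<open>Q\<close> involves
    \<open>x\<^sub>i\<close> or \<open>x\<^sub>j\<close>. As \<open>w\<close> is free of
    \<open>x\<^sub>j\<close>, membership would make \<open>x\<^sub>i\<close> divide it.\<close>
  have "w \<notin> Q"
  proof
    assume "w \<in> Q"
    with \<open>w \<in> polys_in (- {j})\<close> Q(2) have "w \<in> supported {u. i \<in> keys u}"
      by (auto simp: polys_in_def supported_def subset_eq)
    then have "var i dvd w" by (rule var_dvd_if_supported)
    with w(2) show False ..
  qed
  moreover have "var i ^ k * w \<in> Q" using \<open>c \<in> Q\<close> unfolding w(1) .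
  ultimately have "var i ^ k \<in> Q" using prime_ideal_mult_iff[OF Q(1)] by simp
  then show ?thesis by (rule prime_ideal_power[OF Q(1)])
qed

text \<open>In a longer chain, take the prime \<open>Q\<close> just below the top, an irreducible
  \<open>p\<close> in the prime below \<open>Q\<close>, and a \<open>g\<close> in \<open>Q\<close>
  outside that prime. Then \<open>p\<close> does not divide \<open>g\<close>, and eliminating either
  variable puts the other one into \<open>Q\<close>, so \<open>Q\<close> is already the top.\<close>

lemma height_two_vars:
  assumes ij: "i \<noteq> j"
  shows "height (linear_form.prime_over (var i) i (var j :: ('n::finite, 'k::field) mpoly)) = 2"
proof -
  interpret linear_form "var i :: ('n, 'k) mpoly" i by (rule linear_form_var)
  let ?P = "prime_over (var j)"
  have y: "irreducible (var j :: ('n, 'k) mpoly)" "var j \<in> polys_in (- {i})"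
    using irreducible_var ij by auto
  have sup: "?P \<subseteq> supported {u. i \<in> keys u \<or> j \<in> keys u}"
  proof
    fix r assume "r \<in> ?P"
    then obtain z where z: "red r = z * var j" by (auto simp: prime_over_def dvd_def mult.commute)
    obtain w where w: "r - red r = w * var i" using l_dvd_diff_red[of r] by (auto simp: dvd_def mult.commute)
    have r: "r = w * var i + z * var j" unfolding z[symmetric] w[symmetric] by simp
    have "w * var i \<in> supported {u. i \<in> keys u \<or> j \<in> keys u}"
      by (rule supported_mult[of w UNIV _ "{Poly_Mapping.single i 1}"])
        (auto simp: supported_def var_def keys_add_nat)
    moreover have "z * var j \<in> supported {u. i \<in> keys u \<or> j \<in> keys u}"
      by (rule supported_mult[of z UNIV _ "{Poly_Mapping.single j 1}"])
        (auto simp: supported_def var_def keys_add_nat)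
    ultimately show "r \<in> supported {u. i \<in> keys u \<or> j \<in> keys u}"
      unfolding r by (rule supported_add)
  qed
  have "enat k \<le> 2" if C: "\<forall>t\<le>k. prime_ideal (C t)" "\<forall>t<k. C t \<subset> C (Suc t)" "C k = ?P" for k C
  proof (rule ccontr)
    assume "\<not> enat k \<le> 2"
    then have "k \<ge> 3" by (simp add: numeral_eq_enat)
    \<comment> \<open>Only the last four primes of the chain matter, those with indices
      \<open>t\<close> to \<open>t + 3\<close>.\<close>
    then obtain t where t: "k = Suc (Suc (Suc t))" by (metis add.commute add_Suc_right le_Suc_ex numeral_3_eq_3 plus_nat.add_0)
    define Q where "Q = C (Suc (Suc t))"
    have primes: "prime_ideal (C t)" "prime_ideal (C (Suc t))" "prime_ideal Q" using C(1) t by (auto simp: Q_def)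
    have sub: "C t \<subset> C (Suc t)" "C (Suc t) \<subset> Q" "Q \<subset> ?P"
      using C(2) t by (auto simp: Q_def simp flip: C(3))
    have spaces: "ideal.subspace (C t)" "ideal.subspace (C (Suc t))" "ideal.subspace Q"
      using primes by (auto simp: prime_ideal_def)
    obtain a where a: "a \<in> C (Suc t)" "a \<notin> C t" using sub(1) by blast
    then have "a \<noteq> 0" using ideal.subspace_0[OF spaces(1)] by auto
    obtain p where p: "irreducible p" "p \<in> C (Suc t)"
      using prime_ideal_irreducible[OF primes(2) a(1) \<open>a \<noteq> 0\<close>] by blast
    obtain g where g: "g \<in> Q" "g \<notin> C (Suc t)" using sub(2) by blast
    have "\<not> p dvd g"
    proof
      assume "p dvd g"
      then obtain z where "g = z * p" by (auto simp: dvd_def mult.commute)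
      then have "g \<in> C (Suc t)" using ideal.subspace_scale[OF spaces(2) p(2)] by simp
      with g(2) show False ..
    qed
    moreover have pQ: "p \<in> Q" using p sub by blast
    moreover have Q1: "Q \<subseteq> supported {u. i \<in> keys u \<or> j \<in> keys u}" using sub(3) sup by blast
    moreover have Q2: "Q \<subseteq> supported {u. j \<in> keys u \<or> i \<in> keys u}" using Q1 by (simp add: disj_commute)
    ultimately have "var i \<in> Q" "var j \<in> Q"
      using prime_ideal_contains_var[OF primes(3) Q1 p(1) pQ g(1)]
        prime_ideal_contains_var[OF primes(3) Q2 p(1) pQ g(1)] by auto
    then have "?P \<subseteq> Q" using prime_over_subset[OF spaces(3)] by blast
    with sub(3) show False by blast
  qed
  then have "height ?P \<le> 2" unfolding height_def by (intro Sup_least) blast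
  moreover have "enat 2 \<le> height ?P"
  proof (rule height_ge[of _ "\<lambda>t. if t = 0 then {0} else if t = 1 then {r. var i dvd r} else ?P"])
    show "prime_ideal (if t = 0 then {0} else if t = 1 then {r. var i dvd r} else ?P)" for t :: nat
      using prime_ideal_0 prime_ideal_l prime_over_prime_ideal[OF y(1)] by auto
    show "(if t = 0 then {0} else if t = 1 then {r. var i dvd r} else ?P)
      \<subset> (if Suc t = 0 then {0} else if Suc t = 1 then {r. var i dvd r} else ?P)" if "t < 2" for t :: nat
    proof -
      consider "t = 0" | "t = 1" using \<open>t < 2\<close> by linarith
      then show ?thesis using prime_over_strict[OF y] by cases auto
    qed
  qed simp
  ultimately show ?thesis by (simp add: numeral_eq_enat)
qed

section \<open>The upper bound for the degree\<close>

lemma span_three: "x \<in> ideal.span {a, b, c} \<longleftrightarrow> (\<exists>u v w. x = u * a + v * b + w * c)"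
proof -
  have "x \<in> ideal.span {a, b, c} \<longleftrightarrow> (\<exists>u v w. x - u * a - v * b = w * c)"
    by (simp add: ideal.span_breakdown_eq ideal.span_singleton image_iff del: insert_iff)
  also have "\<dots> \<longleftrightarrow> (\<exists>u v w. x = u * a + v * b + w * c)"
    by (simp add: diff_eq_eq add.commute add.left_commute)
  finally show ?thesis .
qed

lemma associated_primes_subset:
  assumes "P \<in> associated_primes J" "ideal.subspace J" shows "J \<subseteq> P"
  using assms ideal.subspace_scale[OF assms(2)] by (auto simp: associated_primes_def mult.commute)

lemma tdeg_power:
  fixes p :: "('n::finite, 'k::field) mpoly"
  assumes "p \<noteq> 0" shows "tdeg (p ^ k) = k * tdeg p"
proof (induction k)
  case 0
  then show ?case using tdeg_const[of 1] by (simp add: const_1)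
next
  case (Suc k)
  then show ?case using assms by (simp add: tdeg_mult)
qed

lemma prod_nonzero:
  fixes f :: "'s \<Rightarrow> ('n::finite, 'k::field) mpoly"
  assumes "finite S" "\<And>s. s \<in> S \<Longrightarrow> f s \<noteq> 0"
  shows "prod f S \<noteq> 0 \<and> tdeg (prod f S) = (\<Sum>s\<in>S. tdeg (f s))"
  using assms
proof (induction S)
  case empty
  then show ?case using tdeg_const[of 1] by (simp add: const_1)
next
  case (insert s S)
  then show ?case by (simp add: tdeg_mult)
qed

context linear_form
begin

text \<open>Different primes in \<open>T\<close> have non-associated generators, since
  \<open>prime_over p\<close> depends on \<open>p\<close> only up to units. Their powers are
  therefore coprime, and each can be split off in turn.\<close>

lemma prod_powers_dvd:
  assumes "finite T"
    and p: "\<And>P. P \<in> T \<Longrightarrow> irreducible (p P) \<and> p P \<in> polys_in (- {i}) \<and> P = prime_over (p P)"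
    and g: "\<And>P. P \<in> T \<Longrightarrow> p P ^ e P dvd g"
  shows "(\<Prod>P\<in>T. p P ^ e P) dvd g"
  using assms
proof (induction T)
  case (insert P T)
  then have "(\<Prod>Q\<in>T. p Q ^ e Q) dvd g" by simp
  then obtain w where w: "g = (\<Prod>Q\<in>T. p Q ^ e Q) * w" by (auto simp: dvd_def)
  have pP: "irreducible (p P)" using insert.prems by simp
  note primes = insert.prems(1) and new = insert.hyps(2)
  have "\<not> p P dvd (\<Prod>Q\<in>S. p Q ^ e Q)" if "finite S" "S \<subseteq> T" for S
    using that
  proof (induction S)
    case empty
    then show ?case using pP by (simp add: irreducible_def)
  next
    case (insert Q S)
    have Q: "irreducible (p Q)" "Q = prime_over (p Q)" and PP: "P = prime_over (p P)"
      using primes[of Q] primes[of P] insert.prems by auto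
    have "\<not> p P dvd p Q ^ e Q"
    proof
      assume "p P dvd p Q ^ e Q"
      then have "p P dvd p Q"
        using irreducible_imp_prime_elem_mpoly[OF pP] prime_elem_dvd_power by blast
      then obtain z where z: "p Q = p P * z" by (auto simp: dvd_def)
      have "\<not> p P dvd 1" using pP by (simp add: irreducible_def)
      then have "z dvd 1" using irreducibleD[OF Q(1) z] by simp
      then have "p P * z dvd p P" using mult_dvd_mono[OF dvd_refl, of z 1 "p P"] by simp
      then have "p P * z dvd r \<longleftrightarrow> p P dvd r" for r
        using dvd_mult_left dvd_trans by blast
      then have "prime_over (p Q) = prime_over (p P)" by (simp add: prime_over_def z)
      then have "P = Q" using Q(2) PP by simp
      then show False using insert.prems new by auto
    qed
    then show ?case using insert by (simp add: irreducible_dvd_mult[OF pP])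
  qed
  then have "\<not> p P dvd (\<Prod>Q\<in>T. p Q ^ e Q)" using insert.hyps by blast
  moreover have "p P ^ e P dvd (\<Prod>Q\<in>T. p Q ^ e Q) * w" using insert.prems w by simp
  ultimately have "p P ^ e P dvd w" using irreducible_power_dvd_cancel[OF pP] by blast
  then obtain w' where "w = p P ^ e P * w'" by (auto simp: dvd_def)
  then show ?case using insert.hyps by (simp add: w mult.left_commute mult_dvd_mono)
qed simp

text \<open>The exponent \<open>e\<close> is the smaller of the multiplicities of \<open>p\<close>
  in the two residues, or that in \<open>red f\<close> if \<open>red g = 0\<close>, and
  \<open>s\<close> is the cofactor where it is attained. The divisibilities feed the common divisor,
  while \<open>p ^ e * s \<in> J\<close> bounds the local length.\<close>

lemma common_power:
  assumes p: "irreducible p" and J: "ideal.subspace J" "f \<in> J" "g \<in> J" "l \<in> J" and f: "red f \<noteq> 0"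
  shows "\<exists>e s. p ^ e dvd red f \<and> p ^ e dvd red g \<and> p ^ e * s \<in> J \<and> s \<notin> prime_over p"
proof -
  have single: "\<exists>k u. red h = p ^ k * u \<and> p ^ k * u \<in> J \<and> u \<notin> prime_over p" if h: "h \<in> J" "red h \<noteq> 0" for h
  proof -
    obtain k u where ku: "red h = p ^ k * u" "\<not> p dvd u" using irreducible_power_split[OF p h(2)] by blast
    have "u \<in> polys_in (- {i})" using polys_in_dvd[OF _ red_in h(2), of u] ku(1) by simp
    then have "u \<notin> prime_over p" using ku(2) by (simp add: prime_over_def)
    moreover have "red h \<in> J" using mem_ideal_red J(1,4) h(1) by blast
    ultimately show ?thesis using ku(1) by metis
  qed
  obtain k u where k: "red f = p ^ k * u" "p ^ k * u \<in> J" "u \<notin> prime_over p"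
    using single[OF J(2) f] by blast
  show ?thesis
  proof (cases "red g = 0")
    case True
    then show ?thesis using k by (intro exI[of _ k] exI[of _ u]) simp
  next
    case False
    obtain m v where m: "red g = p ^ m * v" "p ^ m * v \<in> J" "v \<notin> prime_over p"
      using single[OF J(3) False] by blast
    show ?thesis
    proof (cases "k \<le> m")
      case True
      then show ?thesis using k m(1) le_imp_power_dvd[of k m p]
        by (intro exI[of _ k] exI[of _ u]) auto
    next
      case False
      then show ?thesis using k(1) m le_imp_power_dvd[of m k p]
        by (intro exI[of _ m] exI[of _ v]) auto
    qed
  qed
qed

text \<open>Equality would force the product of the powers of the primes over \<open>J\<close>, which divides both
  \<open>red f\<close> and \<open>red g\<close>, to be \<open>red f\<close> up to a unit.\<close>

lemma codim2_degree_neq: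
  assumes n: "CARD('n) \<ge> 3" and f: "f \<in> forms (int d)" "d > 0"
    and nz: "red f \<noteq> 0" and ndvd: "\<not> red f dvd red g"
  shows "codim2_degree (ideal.span {l, f, g}) \<noteq> of_nat d"
proof
  define J where "J = ideal.span {l, f, g}"
  define T where "T = {P \<in> associated_primes J. height P = 2}"
  assume "codim2_degree (ideal.span {l, f, g}) = of_nat d"
  then have eq: "(\<Sum>P\<in>T. of_nat (the_enat (local_length J P)) * hilbert_degree P) = of_nat d"
    by (simp add: codim2_degree_def J_def T_def)
  \<comment> \<open>A sum over an infinite set is \<open>0\<close> by convention, which differs from
    the positive value \<open>d\<close>.\<close>
  then have fin: "finite T" using f(2) by (metis of_nat_0_eq_iff less_numeral_extra(3) sum.infinite)
  have J: "ideal.subspace J" "l \<in> J" "f \<in> J" "g \<in> J"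
    by (auto simp: J_def intro: ideal.span_base)
  have "\<exists>p. irreducible p \<and> p \<in> polys_in (- {i}) \<and> P = prime_over p" if "P \<in> T" for P
  proof -
    have "P \<in> associated_primes J" using that by (simp add: T_def)
    then have P: "prime_ideal P" "height P = 2" "J \<subseteq> P"
      using that associated_primes_subset[OF _ J(1)] by (auto simp: T_def associated_primes_def)
    have "l \<in> P" "f \<in> P" "\<not> l dvd f" using J P(3) nz by (auto simp flip: red_eq_0_iff)
    then show ?thesis using height_two_prime[OF P(1,2)] by metis
  qed
  then obtain p where p: "\<And>P. P \<in> T \<Longrightarrow> irreducible (p P) \<and> p P \<in> polys_in (- {i}) \<and> P = prime_over (p P)"
    by metis
  have "\<forall>P\<in>T. \<exists>e s. p P ^ e dvd red f \<and> p P ^ e dvd red g \<and> p P ^ e * s \<in> J \<and> s \<notin> prime_over (p P)"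
    using common_power J nz p by blast
  then obtain e where e: "\<And>P. P \<in> T \<Longrightarrow> p P ^ e P dvd red f \<and> p P ^ e P dvd red g \<and>
      (\<exists>s. p P ^ e P * s \<in> J \<and> s \<notin> prime_over (p P))"
    by metis
  have nontriv: "p P dvd red f \<or> e P = 0" if "P \<in> T" for P
    using e[OF that] by (cases "e P") (auto dest: dvd_mult_left)
  have summand_le: "of_nat (the_enat (local_length J P)) * hilbert_degree P \<le> of_nat (e P * tdeg (p P))"
    if P: "P \<in> T" for P
  proof -
    obtain s where "p P ^ e P * s \<in> J" "s \<notin> prime_over (p P)" using e[OF P] by blast
    then have "local_length J (prime_over (p P)) \<le> enat (e P)"
      using p[OF P] J by (intro local_length_le) auto
    then have len: "the_enat (local_length J P) \<le> e P"
      using p[OF P] by (metis enat_ile enat_ord_simps(1) the_enat.simps)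
    \<comment> \<open>For \<open>e P = 0\<close> the length is zero and both sides vanish. Otherwise
      \<open>p P\<close> divides the form \<open>red f\<close>, hence is homogeneous, as the
      computation of its Hilbert degree requires.\<close>
    show ?thesis
    proof (cases "e P = 0")
      case False
      then have "p P dvd red f" using nontriv[OF P] by simp
      from forms_dvd[OF this red_forms[OF f(1)] nz]
      have "p P \<in> forms (int (tdeg (p P)))" .
      then have "hilbert_degree P = of_nat (tdeg (p P))"
        using hilbert_degree_prime_over[of "p P"] p[OF P] n by simp
      then show ?thesis using len by (simp add: mult_right_mono)
    qed (use len in simp)
  qed
  define \<Pi> where "\<Pi> = (\<Prod>P\<in>T. p P ^ e P)"
  have pnz: "p P \<noteq> 0" if "P \<in> T" for P using p[OF that] by (auto simp: irreducible_def)
  have \<Pi>: "tdeg \<Pi> = (\<Sum>P\<in>T. e P * tdeg (p P))"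
    unfolding \<Pi>_def using prod_nonzero[OF fin, of "\<lambda>P. p P ^ e P"] pnz by (simp add: tdeg_power)
  have "\<Pi> dvd red f" "\<Pi> dvd red g"
    unfolding \<Pi>_def using p e by (auto intro!: prod_powers_dvd[OF fin])
  then obtain w where w: "red f = \<Pi> * w" by (auto simp: dvd_def)
  have "of_nat d \<le> (of_nat (tdeg \<Pi>) :: rat)"
    unfolding eq[symmetric] \<Pi> of_nat_sum using summand_le by (intro sum_mono)
  then have "d \<le> tdeg \<Pi>" by simp
  moreover have "\<Pi> \<noteq> 0" "w \<noteq> 0" using w nz by auto
  moreover have "tdeg (red f) = d" using red_forms[OF f(1)] nz by (rule forms_tdeg)
  ultimately have "tdeg w = 0" using w by (simp add: tdeg_mult)
  then have "w dvd 1" using \<open>w \<noteq> 0\<close> by (simp add: mpoly_unit_iff)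
  then have "\<Pi> * w dvd \<Pi>" using mult_dvd_mono[OF dvd_refl, of w 1 \<Pi>] by simp
  then have "red f dvd \<Pi>" by (simp add: w)
  then have "red f dvd red g" using \<open>\<Pi> dvd red g\<close> by (rule dvd_trans)
  with ndvd show False ..
qed

end

section \<open>Degree vectors starting with one\<close>

lemma linear_form_exists:
  assumes "l \<in> forms 1" "l \<noteq> 0" obtains i where "linear_form l i"
proof -
  have "\<exists>i. l \<notin> polys_in (- {i})"
  proof (rule ccontr)
    assume "\<nexists>i. l \<notin> polys_in (- {i})"
    then have "l \<in> polys_in {}" using polys_in_Inter[of l "{}"] by blast
    then obtain c where "l = const c" by (rule polys_in_empty)
    then have "l \<in> forms 0" by (simp add: forms_const)
    then have "(1 :: int) = 0" using forms_unique[OF assms(1) _ assms(2)] by blast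
    then show False by simp
  qed
  then show ?thesis using that assms by (auto simp: linear_form_def)
qed

lemma degree_vector_independent:
  assumes "has_degree_vector d1 d2 d3 f1 f2 f3 J"
  shows "f2 \<notin> ideal.span {f1, f3}" "f3 \<notin> ideal.span {f1, f2}"
proof -
  have J: "J = ideal.span {f1, f2, f3}" "J \<noteq> ideal.span {f1, f3}" "J \<noteq> ideal.span {f1, f2}"
    using assms unfolding has_degree_vector_def by blast+
  show "f2 \<notin> ideal.span {f1, f3}"
  proof
    assume "f2 \<in> ideal.span {f1, f3}"
    then have "ideal.span {f1, f2, f3} = ideal.span {f1, f3}"
      unfolding ideal.span_eq by (auto intro: ideal.span_base)
    with J(1,2) show False by simp
  qed
  show "f3 \<notin> ideal.span {f1, f2}"
  proof
    assume "f3 \<in> ideal.span {f1, f2}"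
    then have "ideal.span {f1, f2, f3} = ideal.span {f1, f2}"
      unfolding ideal.span_eq by (auto intro: ideal.span_base)
    with J(1,3) show False by simp
  qed
qed

lemma span_const_cancel:
  fixes f :: "('n, 'k::field) mpoly"
  assumes "a * f1 + const b * f + c * f2 = 0" "b \<noteq> 0"
  shows "f \<in> ideal.span {f1, f2}"
proof -
  have "const b * f = - (a * f1 + c * f2)" using assms(1) by (simp add: eq_neg_iff_add_eq_0 algebra_simps)
  moreover have "a * f1 + c * f2 \<in> ideal.span {f1, f2}"
    by (intro ideal.span_add ideal.span_scale ideal.span_base) auto
  ultimately have "const b * f \<in> ideal.span {f1, f2}" using ideal.span_neg by metis
  then have "const (inverse b) * (const b * f) \<in> ideal.span {f1, f2}" by (rule ideal.span_scale)
  moreover have "const (inverse b) * (const b * f) = f"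
    using const_inverse[OF assms(2)] by (metis mult.assoc mult.commute mult_1)
  ultimately show ?thesis by simp
qed

lemma indeg_syz_eq:
  fixes f1 f2 f3 :: "('n::finite, 'k::field) mpoly"
  assumes dv: "has_degree_vector 1 d2 d3 f1 f2 f3 J"
  shows "indeg_syz 1 d2 d3 f1 f2 f3 = int d2 + 1"
  unfolding indeg_syz_def
proof (rule Least_equality)
  have f: "f1 \<noteq> 0" "f2 \<noteq> 0" "f1 \<in> forms (int 1)" "f2 \<in> forms (int d2)" "d2 \<le> d3"
    using dv by (simp_all add: has_degree_vector_def)
  note indep = degree_vector_independent[OF dv]
  have "(f2, - f1, 0) \<in> syz 1 d2 d3 f1 f2 f3 (int d2 + 1)"
    using f by (simp add: syz_def forms_uminus mult.commute)
  then show "syz 1 d2 d3 f1 f2 f3 (int d2 + 1) \<noteq> {(0, 0, 0)}" using f(2) by auto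
  fix q assume q: "syz 1 d2 d3 f1 f2 f3 q \<noteq> {(0, 0, 0)}"
  show "int d2 + 1 \<le> q"
  proof (rule ccontr)
    assume "\<not> int d2 + 1 \<le> q"
    \<comment> \<open>Only the last two coefficients are forced to be constants; the one at
      \<open>f1\<close> may still have positive degree.\<close>
    then have q': "q - int d2 \<le> 0" "q - int d3 \<le> 0" using f(5) by simp_all
    have const: "\<exists>c. a = const c" if "a \<in> forms m" "m \<le> 0" for a :: "('n, 'k) mpoly" and m
    proof (cases "m = 0")
      case True
      then show ?thesis using that(1) forms_0_const by blast
    next
      case False
      then have "a = const 0" using that forms_neg[of a m] by simp
      then show ?thesis ..
    qed
    have "a1 = 0 \<and> a2 = 0 \<and> a3 = 0" if a: "(a1, a2, a3) \<in> syz 1 d2 d3 f1 f2 f3 q" for a1 a2 a3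
    proof -
      obtain b c where bc: "a2 = const b" "a3 = const c"
        using const[OF _ q'(1), of a2] const[OF _ q'(2), of a3] a by (auto simp: syz_def)
      have eq: "a1 * f1 + const b * f2 + const c * f3 = 0" using a bc by (simp add: syz_def)
      then have eq': "a1 * f1 + const c * f3 + const b * f2 = 0" by (simp only: ac_simps)
      have "b = 0" using span_const_cancel[OF eq] indep(1) by blast
      moreover have "c = 0" using span_const_cancel[OF eq'] indep(2) by blast
      \<comment> \<open>What remains is \<open>a1 * f1 = 0\<close> in a domain.\<close>
      ultimately show ?thesis using eq bc f(1) by simp
    qed
    moreover have "(0, 0, 0) \<in> syz 1 d2 d3 f1 f2 f3 q" by (simp add: syz_def)
    ultimately have "syz 1 d2 d3 f1 f2 f3 q = {(0, 0, 0)}" by auto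
    with q show False ..
  qed
qed

text \<open>Minimality is transferred to residues: \<open>red f2 = 0\<close> would put
  \<open>f2\<close> into \<open>(f1)\<close>, and divisibility of \<open>red f3\<close> by
  \<open>red f2\<close> would put \<open>f3\<close> into \<open>(f1, f2)\<close>.\<close>

lemma degree_vector_codim2_degree_neq:
  fixes f1 f2 f3 :: "('n::finite, 'k::field) mpoly"
  assumes dv: "has_degree_vector 1 d2 d3 f1 f2 f3 J" and n: "CARD('n) \<ge> 3"
  shows "codim2_degree J \<noteq> of_nat d2"
proof -
  have f: "f1 \<noteq> 0" "f1 \<in> forms 1" "f2 \<in> forms (int d2)" "d2 > 0" "J = ideal.span {f1, f2, f3}"
    using dv by (simp_all add: has_degree_vector_def)
  note indep = degree_vector_independent[OF dv]
  obtain i where "linear_form f1 i" using linear_form_exists[OF f(2,1)] .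
  then interpret linear_form f1 i .
  have "red f2 \<noteq> 0"
  proof
    assume "red f2 = 0"
    then obtain z where z: "f2 = z * f1" by (auto simp: red_eq_0_iff dvd_def mult.commute)
    have "f2 \<in> ideal.span {f1, f3}" unfolding z by (intro ideal.span_scale ideal.span_base) simp
    with indep show False by blast
  qed
  moreover have "\<not> red f2 dvd red f3"
  proof
    assume "red f2 dvd red f3"
    then obtain z where z: "red f3 = z * red f2" by (auto simp: dvd_def mult.commute)
    have S: "ideal.subspace (ideal.span {f1, f2})" "f1 \<in> ideal.span {f1, f2}" "f2 \<in> ideal.span {f1, f2}"
      by (auto intro: ideal.span_base)
    have "red f2 \<in> ideal.span {f1, f2}" using mem_ideal_red[OF S(1,2)] S(3) by blast
    then have "red f3 \<in> ideal.span {f1, f2}" unfolding z by (rule ideal.span_scale)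
    then have "f3 \<in> ideal.span {f1, f2}" using mem_ideal_red[OF S(1,2)] by blast
    with indep show False by blast
  qed
  ultimately show ?thesis unfolding f(5) using codim2_degree_neq[OF n f(3,4)] by blast
qed

section \<open>Realization by monomial ideals\<close>

text \<open>Sets of exponents closed under addition of arbitrary exponents describe monomial ideals,
  so non-membership can be tested on a single exponent.\<close>

lemma supported_ideal:
  assumes "\<And>u w. u \<in> U \<Longrightarrow> w + u \<in> U"
  shows "ideal.subspace (supported U)"
proof (rule ideal.subspaceI)
  fix c p :: "('a, 'b) mpoly" assume "p \<in> supported U"
  then show "c * p \<in> supported U"
    using assms by (intro supported_mult[of c UNIV p U]) (auto simp: supported_def)
qed (auto intro: supported_add)

lemma span_supported:
  assumes "S \<subseteq> supported U" "\<And>u w. u \<in> U \<Longrightarrow> w + u \<in> U"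
  shows "ideal.span S \<subseteq> supported U"
  using assms(1) supported_ideal[OF assms(2)] by (rule ideal.span_minimal)

lemma var_not_dvd_var_power:
  fixes j k :: "'n::finite"
  assumes "j \<noteq> k" shows "\<not> (var j :: ('n, 'k::field) mpoly) dvd var k ^ N"
proof
  assume "(var j :: ('n, 'k) mpoly) dvd var k ^ N"
  then have "(var j :: ('n, 'k) mpoly) dvd var k"
    using irreducible_imp_prime_elem_mpoly[OF irreducible_var] prime_elem_dvd_power by blast
  then have "(var j :: ('n, 'k) mpoly) \<in> polys_in {k}"
    by (rule polys_in_dvd) simp_all
  with assms show False by simp
qed

lemma monomial_in_supported:
  "var j ^ a * var k ^ b \<in> (supported U :: ('n, 'k::field) mpoly set)
    \<longleftrightarrow> Poly_Mapping.single j a + Poly_Mapping.single k b \<in> U"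
  by (simp add: var_power mult_single supported_def)

lemma var_power_in_supported:
  "var j ^ a \<in> (supported U :: ('n, 'k::field) mpoly set) \<longleftrightarrow> Poly_Mapping.single j a \<in> U"
  by (simp add: var_power supported_def)

lemma var_in_supported:
  "var j \<in> (supported U :: ('n, 'k::field) mpoly set) \<longleftrightarrow> Poly_Mapping.single j 1 \<in> U"
  by (simp add: var_def supported_def)

lemma monomial_degree_vector:
  fixes x y z :: "'n::finite"
  assumes xyz: "x \<noteq> y" "x \<noteq> z" "y \<noteq> z" and d: "1 < d2" "d2 \<le> d3" "e < d2"
  defines "f1 \<equiv> var x :: ('n, 'k::field) mpoly" and "f2 \<equiv> var y ^ d2" and "f3 \<equiv> var y ^ e * var z ^ (d3 - e)"
  shows "has_degree_vector 1 d2 d3 f1 f2 f3 (ideal.span {f1, f2, f3})"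
proof -
  have mem: "f1 \<in> ideal.span {f1, f2, f3}" "f2 \<in> ideal.span {f1, f2, f3}" "f3 \<in> ideal.span {f1, f2, f3}"
    by (auto intro: ideal.span_base)
  have lookups: "lookup (Poly_Mapping.single a b) c = (if a = c then b else 0)" for a c :: 'n and b :: nat
    by (simp add: lookup_single when_def)
  \<comment> \<open>The three sets describe the monomial ideals \<open>(y^d2, z^(d3-e))\<close>,
    \<open>(x, z)\<close> and \<open>(x, y^d2)\<close>. Each contains two of the generators and
    misses the third; for the last one this is where \<open>e < d2\<close> enters.\<close>
  let ?U1 = "{u. d2 \<le> lookup u y \<or> d3 - e \<le> lookup u z}"
  have "ideal.span {f2, f3} \<subseteq> supported ?U1"
    by (rule span_supported) (auto simp: f2_def f3_def monomial_in_supported var_power_in_supported lookup_add lookups)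
  moreover have "f1 \<notin> supported ?U1"
    using d xyz by (simp add: f1_def var_in_supported lookups)
  ultimately have 1: "ideal.span {f1, f2, f3} \<noteq> ideal.span {f2, f3}" using mem(1) by blast
  let ?U2 = "{u. 1 \<le> lookup u x \<or> 1 \<le> lookup u z}"
  have "ideal.span {f1, f3} \<subseteq> supported ?U2"
    using d by (intro span_supported)
      (auto simp: f1_def var_in_supported f3_def monomial_in_supported var_power_in_supported lookup_add lookups)
  moreover have "f2 \<notin> supported ?U2"
    using xyz by (simp add: f2_def var_power_in_supported lookups)
  ultimately have 2: "ideal.span {f1, f2, f3} \<noteq> ideal.span {f1, f3}" using mem(2) by blast
  let ?U3 = "{u. 1 \<le> lookup u x \<or> d2 \<le> lookup u y}"
  have "ideal.span {f1, f2} \<subseteq> supported ?U3"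
    using d by (intro span_supported)
      (auto simp: f1_def var_in_supported f2_def monomial_in_supported var_power_in_supported lookup_add lookups)
  moreover have "f3 \<notin> supported ?U3"
    using xyz d by (simp add: f3_def monomial_in_supported lookup_add lookups)
  ultimately have 3: "ideal.span {f1, f2, f3} \<noteq> ideal.span {f1, f2}" using mem(3) by blast
  have gcd: "g dvd 1" if g: "g dvd f1" "g dvd f2" for g
  proof -
    obtain h where h: "f1 = g * h" using g(1) by (auto simp: dvd_def)
    have irr: "irreducible f1" unfolding f1_def by (rule irreducible_var)
    show ?thesis
    proof (rule ccontr)
      assume "\<not> g dvd 1"
      then have "h dvd 1" using irreducibleD[OF irr h] by simp
      then have "g * h dvd g" using mult_dvd_mono[OF dvd_refl, of h 1 g] by simp
      then have "f1 dvd f2" using g(2) unfolding h by (rule dvd_trans)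
      then show False unfolding f1_def f2_def using var_not_dvd_var_power[OF xyz(1)] by blast
    qed
  qed
  have "f3 \<in> forms (int e + int (d3 - e))"
    unfolding f3_def by (rule forms_mult[OF forms_var_power forms_var_power])
  then have "f3 \<in> forms (int d3)" using d by (simp add: of_nat_diff)
  moreover have "f1 \<in> forms (int 1)" "f2 \<in> forms (int d2)"
    using forms_var by (simp_all add: f1_def f2_def forms_var_power)
  moreover have "f1 \<noteq> 0" "f2 \<noteq> 0" "f3 \<noteq> 0"
    by (simp_all add: f1_def f2_def f3_def)
  moreover have "\<forall>g. g dvd f1 \<and> g dvd f2 \<and> g dvd f3 \<longrightarrow> g dvd 1"
    using gcd by simp
  moreover have "1 \<le> d2" using d(1) by simp
  ultimately show ?thesis using 1 2 3 d(2) unfolding has_degree_vector_def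
    by (intro conjI) (assumption | rule refl order_refl)+
qed

text \<open>At the prime \<open>(x, y)\<close> the variable \<open>z\<close> is invertible, so the
  ideal becomes \<open>(x, y^e)\<close> there and has local length \<open>e\<close>; no other
  associated prime has height two.\<close>

lemma monomial_codim2_degree:
  fixes x y z :: "'n::finite"
  assumes xyz: "x \<noteq> y" "x \<noteq> z" "y \<noteq> z" and d: "e < d" "d \<le> d'" and n: "CARD('n) \<ge> 3"
  shows "codim2_degree (ideal.span {var x :: ('n, 'k::field) mpoly, var y ^ d, var y ^ e * var z ^ (d' - e)})
    = of_nat e"
proof -
  define N where "N = d' - e"
  define J where "J = ideal.span {var x :: ('n, 'k) mpoly, var y ^ d, var y ^ e * var z ^ N}"
  interpret linear_form "var x :: ('n, 'k) mpoly" x by (rule linear_form_var)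
  define P where "P = (prime_over (var y) :: ('n, 'k) mpoly set)"
  have irr: "irreducible (var y :: ('n, 'k) mpoly)" by (rule irreducible_var)
  have redy: "red (var y) = var y" "red (var z) = var z" using xyz by simp_all
  have J: "ideal.subspace J" "var x \<in> J" "var y ^ d \<in> J" "var y ^ e * var z ^ N \<in> J"
    by (auto simp: J_def intro: ideal.span_base)
  have P: "prime_ideal P" "height P = 2"
    using prime_over_prime_ideal[OF irr] height_two_vars[OF xyz(1)] by (simp_all add: P_def)
  have zP: "var z ^ N \<notin> P" using var_not_dvd_var_power[OF xyz(3)] by (simp add: P_def prime_over_def red_power redy)
  have J_dvd: "var y ^ e dvd red g" if gJ: "g \<in> J" for g
  proof -
    obtain a b c where g: "g = a * var x + b * var y ^ d + c * (var y ^ e * var z ^ N)"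
      using gJ unfolding J_def span_three by blast
    have "var y ^ e dvd (var y ^ d :: ('n, 'k) mpoly)" using d by (intro le_imp_power_dvd) simp
    then show ?thesis unfolding g by (simp add: red_add red_mult red_power redy)
  qed
  \<comment> \<open>Such a \<open>Q\<close> contains \<open>x\<close> and a power of
    \<open>y\<close>, hence \<open>P\<close>, and a strict inclusion would give it height at least
    three.\<close>
  have over: "Q = P" if Q: "Q \<in> associated_primes J" "height Q = 2" for Q
  proof -
    have Q': "prime_ideal Q" "ideal.subspace Q" "J \<subseteq> Q"
      using Q(1) associated_primes_subset[OF Q(1) J(1)] by (auto simp: associated_primes_def prime_ideal_def)
    have "var y \<in> Q" using prime_ideal_power[OF Q'(1)] J(3) Q'(3) by blast
    then have "P \<subseteq> Q" unfolding P_def using prime_over_subset[OF Q'(2)] J(2) Q'(3) by blast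
    moreover have "\<not> P \<subset> Q"
    proof
      assume "P \<subset> Q"
      then have "3 \<le> height Q" unfolding P_def using height_gt_prime_over[OF irr _ Q'(1)] xyz by simp
      then show False using Q(2) by simp
    qed
    ultimately show ?thesis by blast
  qed
  have "codim2_degree J = of_nat e"
  proof (cases "e = 0")
    \<comment> \<open>For \<open>e = 0\<close> the power of \<open>z\<close> lies in
      \<open>J\<close> but not in \<open>P\<close>, so the sum is empty.\<close>
    case True
    have "P \<notin> associated_primes J"
    proof
      assume "P \<in> associated_primes J"
      then have "J \<subseteq> P" using J(1) by (rule associated_primes_subset)
      then show False using J(4) zP True by auto
    qed
    then have T: "{Q \<in> associated_primes J. height Q = 2} = {}" using over by blast
    show ?thesis unfolding codim2_degree_def T using True by simp
  next
    case False
    then obtain e' where e': "e = Suc e'" by (cases e) auto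
    \<comment> \<open>One factor \<open>y\<close> short of the third generator: the class of
      \<open>a\<close> is annihilated precisely by \<open>P\<close>.\<close>
    define a where "a = (var y ^ e' * var z ^ N :: ('n, 'k) mpoly)"
    have "r * a \<in> J \<longleftrightarrow> r \<in> P" for r
    proof
      assume "r * a \<in> J"
      from J_dvd[OF this] have "var y ^ e' * var y dvd var y ^ e' * (var z ^ N * red r)"
        by (simp add: a_def e' red_mult red_power redy ac_simps)
      then have "var y dvd var z ^ N * red r" by (simp only: mpoly_dvd_mult_cancel_left[of "var y ^ e'"] mpoly_power_eq_0_iff var_nonzero simp_thms)
      then show "r \<in> P"
        using var_not_dvd_var_power[OF xyz(3)] by (auto simp: irreducible_dvd_mult[OF irr] P_def prime_over_def)
    next
      assume "r \<in> P"
      then obtain w where w: "red r = w * var y" by (auto simp: P_def prime_over_def dvd_def mult.commute)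
      have "red r * a = w * (var y ^ e * var z ^ N)" unfolding w a_def e' by (simp add: ac_simps)
      then have "red r * a \<in> J" using ideal.subspace_scale[OF J(1,4)] by simp
      moreover obtain v where v: "r - red r = v * var x" using l_dvd_diff_red[of r] by (auto simp: dvd_def mult.commute)
      have "(r - red r) * a = (v * a) * var x" unfolding v by (simp add: ac_simps)
      then have "(r - red r) * a \<in> J" using ideal.subspace_scale[OF J(1,2)] by simp
      ultimately have "red r * a + (r - red r) * a \<in> J" by (rule ideal.subspace_add[OF J(1)])
      then show "r * a \<in> J" by (simp add: algebra_simps)
    qed
    then have "P = {r. r * a \<in> J}" by blast
    then have "P \<in> associated_primes J" using P(1) unfolding associated_primes_def by blast
    then have T: "{Q \<in> associated_primes J. height Q = 2} = {P}" using over P(2) by blast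
    have "local_length J P \<le> enat e"
      unfolding P_def using local_length_le[OF irr J(1,2,4)] zP P_def by simp
    moreover have "enat e \<le> local_length J P"
      unfolding P_def using xyz by (intro local_length_ge[OF irr _ J(1)] J_dvd) simp_all
    ultimately have "local_length J P = enat e" by (rule antisym)
    moreover have "hilbert_degree P = 1"
      unfolding P_def using hilbert_degree_prime_over[OF irr, of 1] xyz n by (simp add: forms_var)
    ultimately show ?thesis unfolding codim2_degree_def T by simp
  qed
  then show ?thesis by (simp add: J_def N_def)
qed

lemma three_elements:
  assumes "CARD('n::finite) \<ge> 3"
  obtains x y z :: "'n::finite" where "x \<noteq> y" "x \<noteq> z" "y \<noteq> z"
proof -
  obtain T :: "'n set" where "card T = 3" using assms obtain_subset_with_card_n by metis
  then show ?thesis using that by (auto simp: card_3_iff)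
qed

theorem proposition1p12:
  fixes d2 d3 :: nat
  assumes n: "CARD('n) \<ge> 3"
    and d: "1 < d2" "d2 \<le> d3"
  shows "(\<forall>(f1 :: ('n::finite, 'k::{alg_closed_field, field_char_0}) mpoly) f2 f3 J.
            has_degree_vector 1 d2 d3 f1 f2 f3 J \<longrightarrow>
            indeg_syz 1 d2 d3 f1 f2 f3 = int d2 + 1)
       \<and> degree_interval (int d2 + 1) 1 d2 d3 = {0..int d2}
       \<and> (\<forall>j. admissible 1 d2 d3 (int d2 + 1) j \<longrightarrow>
            (realizable TYPE('n) TYPE('k) 1 d2 d3 (int d2 + 1) j \<longleftrightarrow> 0 \<le> j \<and> j \<le> int d2 - 1))
       \<and> {j \<in> degree_interval (int d2 + 1) 1 d2 d3.
            \<not> realizable TYPE('n) TYPE('k) 1 d2 d3 (int d2 + 1) j} = {int d2}"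
proof -
  have interval: "degree_interval (int d2 + 1) 1 d2 d3 = {0..int d2}"
  proof -
    have "dsigma 1 d2 d3 - (int d2 + 1) * dsum 1 d2 d3 = - (int d2 * int d2) - int d2 - 1"
      by (simp add: dsigma_def dsum_def algebra_simps)
    moreover have "int d2 * int d2 \<ge> 0" by simp
    ultimately have "max (dsigma 1 d2 d3 - (int d2 + 1) * dsum 1 d2 d3) 0 = 0" by linarith
    \<comment> \<open>With \<open>e = d2 + 1\<close> the sum of the degrees is \<open>e + d3\<close>
      and \<open>dsigma\<close> equals \<open>d2 + e * d3\<close>, so all terms but
      \<open>d2\<close> cancel.\<close>
    moreover have "Fd 1 d2 d3 (int d2 + 1) = int d2"
      by (simp add: Fd_def dsigma_def dsum_def power2_eq_square algebra_simps)
    ultimately show ?thesis by (simp add: degree_interval_def)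
  qed
  have not_d2: "\<not> realizable TYPE('n) TYPE('k) 1 d2 d3 (int d2 + 1) (int d2)"
    using degree_vector_codim2_degree_neq[where 'n = 'n and 'k = 'k] n by (auto simp: realizable_def)
  have real: "realizable TYPE('n) TYPE('k) 1 d2 d3 (int d2 + 1) j" if j: "0 \<le> j" "j \<le> int d2 - 1" for j
  proof -
    obtain x y z :: 'n where xyz: "x \<noteq> y" "x \<noteq> z" "y \<noteq> z" using three_elements n by metis
    obtain e where e: "j = int e" using nonneg_int_cases[OF j(1)] .
    then have ed: "e < d2" using j by simp
    let ?f1 = "var x :: ('n, 'k) mpoly" and ?f2 = "var y ^ d2 :: ('n, 'k) mpoly"
      and ?f3 = "var y ^ e * var z ^ (d3 - e) :: ('n, 'k) mpoly"
    have dv: "has_degree_vector 1 d2 d3 ?f1 ?f2 ?f3 (ideal.span {?f1, ?f2, ?f3})"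
      using monomial_degree_vector[OF xyz d ed] .
    moreover have "codim2_degree (ideal.span {?f1, ?f2, ?f3}) = of_int j"
      using monomial_codim2_degree[OF xyz ed d(2) n] e by simp
    ultimately show ?thesis unfolding realizable_def using indeg_syz_eq[OF dv] by blast
  qed
  have iff: "realizable TYPE('n) TYPE('k) 1 d2 d3 (int d2 + 1) j \<longleftrightarrow> 0 \<le> j \<and> j \<le> int d2 - 1"
    if "j \<in> {0..int d2}" for j
  proof (cases "j = int d2")
    case True
    then show ?thesis using not_d2 by simp
  next
    case False
    then show ?thesis using real[of j] that by auto
  qed
  have "{j \<in> {0..int d2}. \<not> realizable TYPE('n) TYPE('k) 1 d2 d3 (int d2 + 1) j} = {int d2}"
    using iff by auto
  then show ?thesis using indeg_syz_eq interval iff by (auto simp: admissible_def)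
qed

end
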